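(* For every real $\delta>0$ there is a constant $C(\delta)>0$ such that the following holds. Let $q\ge 1$ be an integer, let $L,M,N\ge 1$ be integers and $u,v,w$ be integers, and put $$\mathcal L=\{u+1,\ldots,u+L\},\quad \mathcal M=\{v+1,\ldots,v+M\},\quad \mathcal N=\{w+1,\ldots,w+N\}.$$ Let $\boldsymbol{\alpha}=\{\alpha_\ell\}_{\ell\in\mathcal L}$ be complex weights with $|\alpha_\ell|\le 1$ for all $\ell$ and $\alpha_\ell=0$ whenever $\gcd(\ell,q)>1$. Then $$\left|\mathcal S_q(\boldsymbol{\alpha};\mathcal L,\mathcal M,\mathcal N)\right| \le C(\delta)\, q^{\delta}\min\Bigl\{\bigl(L+L^{1/2}M^{1/2}\bigr)N^{1/2}q^{3/2},\ \bigl(L+L^{3/4}M^{1/4}\bigr)\bigl(N^{1/8}q^{7/4}+N^{1/2}q^{3/2}\bigr)\Bigr\}.$$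
   Context: For an integer $q\ge1$, $\mathbb Z_q$ denotes the residue ring modulo $q$ and $\mathbb Z_q^*$ its group of units; for $x\in\mathbb Z_q^*$, $\overline{x}$ denotes the multiplicative inverse of $x$ modulo $q$; $\mathbf e_q(z)=\exp(2\pi i z/q)$. The double Kloosterman sum is $$\mathcal K_q(\ell,m,n)=\sum_{x,y\in\mathbb Z_q^*}\mathbf e_q\bigl(\ell xy+m\overline{x}+n\overline{y}\bigr),$$ and $$\mathcal S_q(\boldsymbol{\alpha};\mathcal L,\mathcal M,\mathcal N)=\sum_{\ell\in\mathcal L}\alpha_\ell\sum_{m\in\mathcal M}\sum_{n\in\mathcal N}\mathcal K_q(\ell,m,n).$$ (The paper writes the factor $C(\delta)q^{\delta}$ as $q^{o(1)}$, meaning a factor bounded by $q^{o(1)}$ as $q\to\infty$ uniformly in all other data.)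
   Formalization: The modulus is taken to be q ≥ 2 instead of q ≥ 1: for q = 1 every double Kloosterman sum equals 1, so with α = 1 and L = N = 1 the claim would bound M by a constant times 1 + M^{1/2} for all M, which is false. *)

theory Defs
  imports "HOL-Analysis.Analysis" "HOL-Number_Theory.Modular_Inverse"
begin

definition e_mod :: "nat \<Rightarrow> int \<Rightarrow> complex" where
  "e_mod q z = exp (2 * of_real pi * \<i> * of_int z / of_nat q)"

text \<open>
  Units modulo \<open>q\<close>, by their least non-negative representatives. For \<open>q = 1\<close> this is \<open>{0}\<close>,
  the unit group of the zero ring.
\<close>

definition units_mod :: "nat \<Rightarrow> int set" where
  "units_mod q = {x \<in> {0..<int q}. coprime x (int q)}"

definition kloosterman2 :: "nat \<Rightarrow> int \<Rightarrow> int \<Rightarrow> int \<Rightarrow> complex" where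
  "kloosterman2 q l m n =
     (\<Sum>x\<in>units_mod q. \<Sum>y\<in>units_mod q.
        e_mod q (l * x * y + m * modular_inverse (int q) x + n * modular_inverse (int q) y))"

definition kloosterman2_sum ::
    "nat \<Rightarrow> (int \<Rightarrow> complex) \<Rightarrow> int set \<Rightarrow> int set \<Rightarrow> int set \<Rightarrow> complex" where
  "kloosterman2_sum q \<alpha> \<L> \<M> \<N> =
     (\<Sum>l\<in>\<L>. \<alpha> l * (\<Sum>m\<in>\<M>. \<Sum>n\<in>\<N>. kloosterman2 q l m n))"

end

theory Submission
  imports Defs
begin

text \<open>
  Substituting \<open>x \<mapsto> 1/x\<close>, \<open>y \<mapsto> 1/y\<close> and writing \<open>\<phi>\<close> for the exponential sum over an interval,
  the sum becomes \<open>\<Sum>c. W c * V c\<close>, where \<open>W c\<close> collects \<open>\<alpha> l * \<phi>\<^sub>M x\<close> over \<open>l/x = c\<close> and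
  \<open>V c = (\<Sum>y. \<phi>\<^sub>N y * e (c/y))\<close>. The two bounds are Cauchy--Schwarz,
  \<open>|S|\<^sup>2 \<le> \<parallel>W\<parallel>\<^sub>2\<^sup>2 \<parallel>V\<parallel>\<^sub>2\<^sup>2\<close>, and Hoelder, \<open>|S|\<^sup>4 \<le> \<parallel>W\<parallel>\<^sub>1\<^sup>2 \<parallel>W\<parallel>\<^sub>2\<^sup>2 \<parallel>V\<parallel>\<^sub>4\<^sup>4\<close>.
  Since \<open>|\<phi>\<^sub>M x| \<le> min M (q/|x|)\<close>, after a dyadic decomposition of \<open>x\<close> and \<open>y\<close> and Parseval
  the norms reduce to two counting problems modulo \<open>q\<close>. The congruence \<open>l/x = l'/x'\<close> with
  \<open>l, l'\<close> in an interval of length \<open>L\<close> and \<open>|x|, |x'| \<le> X\<close> is grouped by the ratio \<open>r = x/x'\<close>, and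
  the solutions for each \<open>r\<close> are points of the lattice \<open>a = r b\<close> in boxes. The congruence
  \<open>1/x + 1/y = 1/x' + 1/y'\<close> is treated as by Heath-Brown: a Dirichlet approximation \<open>a = k c - h q\<close>
  turns \<open>1/x + 1/y = c\<close> into \<open>(a x - k) (a y - k) = k\<^sup>2 + a q t\<close> with few values of \<open>t\<close>, and the
  divisor bound applies. No bound for individual Kloosterman sums is needed.
\<close>

subsection \<open>The divisor bound\<close>

text \<open>Origin of the exponents, up to constants and powers of \<open>Z\<close>: the first and
  second moments of W are bounded by L q and q (L^2 + L M), the second moment of V by q^2 N;
  Cauchy-Schwarz gives the first bound. On a block of y of size Y, where \<phi> is at most a = min N
  (q/Y), the fourth moment of V is q a^4 (Y^2 + Y^(7/2) q^(-1/2)). As a Y is at most about q, this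
  is at most N^2 q^3 + N^(1/2) q^4, whose fourth roots N^(1/2) q^(3/4) and N^(1/8) q, times (L
  q)^(1/2) (q (L^2 + L M))^(1/4), give the two terms of the second bound. Neither count is uniform:
  a single ratio r, such as r = 1, may have very short lattice vectors, and for composite q a class
  c may share a large divisor with q, which limits the use of Dirichlet approximation. The first is
  met by averaging over r, the second by sorting the classes c by their gcd with q.\<close>

definition divisor_count :: "nat \<Rightarrow> nat" where
  "divisor_count n = card {d. d dvd n}"

lemma divisor_count_prime_power_mult:
  fixes p n :: nat
  assumes "prime p" "n > 0"
  shows "divisor_count (p ^ a * n) \<le> (a + 1) * divisor_count n"
proof -
  have "{d. d dvd p ^ a * n} \<subseteq> (\<lambda>(i, d). p ^ i * d) ` ({..a} \<times> {d. d dvd n})"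
  proof
    fix d assume "d \<in> {d. d dvd p ^ a * n}"
    then obtain b c where "d = b * c" "b dvd p ^ a" "c dvd n"
      by (auto elim: dvd_productE)
    with assms show "d \<in> (\<lambda>(i, d). p ^ i * d) ` ({..a} \<times> {d. d dvd n})"
      by (auto simp: divides_primepow_nat intro!: image_eqI[where x = "(_, c)"])
  qed
  then have "card {d. d dvd p ^ a * n} \<le> card ((\<lambda>(i, d). p ^ i * d) ` ({..a} \<times> {d. d dvd n}))"
    using assms by (intro card_mono) auto
  also have "\<dots> \<le> card ({..a} \<times> {d. d dvd n})"
    using assms by (intro card_image_le) auto
  finally show ?thesis
    by (simp only: divisor_count_def card_cartesian_product card_atMost Suc_eq_plus1)
qed

text \<open>Linear against exponential growth in \<open>a\<close>. With t = \<epsilon> ln 2, a + 1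
  is at most (1 + 1/t) (1 + t a), and 1 + t a is at most exp (t a) = 2^(\<epsilon> a). No constant
  is lost once p^\<epsilon> is at least 2, because a + 1 \<le> 2^a.\<close>

lemma Suc_le_mult_powr:
  fixes \<epsilon> :: real and p a :: nat
  assumes "\<epsilon> > 0" "p \<ge> 2"
  shows "real (a + 1) \<le> (1 + 1 / (\<epsilon> * ln 2)) * real (p ^ a) powr \<epsilon>"
    and "real p powr \<epsilon> \<ge> 2 \<Longrightarrow> real (a + 1) \<le> real (p ^ a) powr \<epsilon>"
proof -
  have eq: "real (p ^ a) powr \<epsilon> = (real p powr \<epsilon>) ^ a"
    using assms by (simp add: powr_realpow[symmetric] powr_powr mult.commute)
  show "real (a + 1) \<le> real (p ^ a) powr \<epsilon>" if "real p powr \<epsilon> \<ge> 2"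
  proof -
    have "real (a + 1) \<le> 2 ^ a"
      by (induction a) auto
    also have "\<dots> \<le> (real p powr \<epsilon>) ^ a"
      using that by (intro power_mono) auto
    finally show ?thesis unfolding eq .
  qed
  have "1 + real a * (\<epsilon> * ln 2) \<le> exp (real a * (\<epsilon> * ln 2))"
    by (rule exp_ge_add_one_self)
  also have "\<dots> = (2 powr \<epsilon>) ^ a"
    by (simp add: powr_def exp_of_nat_mult[symmetric])
  also have "\<dots> \<le> (real p powr \<epsilon>) ^ a"
    using assms by (intro power_mono powr_mono2) auto
  finally have 1: "1 + real a * (\<epsilon> * ln 2) \<le> real (p ^ a) powr \<epsilon>" unfolding eq .
  have pos: "\<epsilon> * ln 2 > 0"
    using assms by simp
  have "real (a + 1) \<le> (1 + 1 / t) * (1 + real a * t)" if "t > 0" for t :: real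
    using that by (simp add: algebra_simps)
  from this[OF pos] have "real (a + 1) \<le> (1 + 1 / (\<epsilon> * ln 2)) * (1 + real a * (\<epsilon> * ln 2))" .
  also have "\<dots> \<le> (1 + 1 / (\<epsilon> * ln 2)) * real (p ^ a) powr \<epsilon>"
    using pos by (intro mult_left_mono 1) auto
  finally show "real (a + 1) \<le> (1 + 1 / (\<epsilon> * ln 2)) * real (p ^ a) powr \<epsilon>" .
qed

text \<open>Peeling off one prime power at a time costs a constant factor only for the finitely many
  primes \<open>p\<close> with \<open>p powr \<epsilon> < 2\<close>.\<close>

lemma divisor_count_le_powr_aux:
  fixes \<epsilon> :: real and n :: nat
  assumes "\<epsilon> > 0" "n > 0"
  defines "S \<equiv> (\<lambda>n::nat. {p. prime p \<and> p dvd n \<and> real p powr \<epsilon> < 2})"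
  shows "real (divisor_count n) \<le> (1 + 1 / (\<epsilon> * ln 2)) ^ card (S n) * real n powr \<epsilon>"
  using \<open>n > 0\<close>
proof (induction n rule: less_induct)
  case (less n)
  define K where "K = 1 + 1 / (\<epsilon> * ln 2)"
  have K: "K \<ge> 1"
    using assms by (simp add: K_def)
  show ?case
  proof (cases "n = 1")
    case True
    have "K ^ card (S n) \<ge> 1"
      using K by simp
    then show ?thesis
      using True by (simp add: divisor_count_def K_def)
  next
    case False
    then obtain p where p: "prime p" "p dvd n"
      using prime_factor_nat by auto
    define a where "a = multiplicity p n"
    obtain m where m: "n = p ^ a * m" "\<not> p dvd m"
      unfolding a_def using multiplicity_decompose'[of n p] less.prems p by (metis not_prime_unit gr_implies_not0)
    have "a > 0"
      using m p by (intro gr0I) auto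
    have "m > 0"
      using less.prems m by (intro gr0I) auto
    have "p \<ge> 2"
      using p by (simp add: prime_ge_2_nat)
    then have "p ^ a \<ge> 2"
      using \<open>a > 0\<close> by (meson dual_order.trans self_le_power le_numeral_extra(4) less_le_trans pos2 one_le_numeral)
    then have "m < n"
      using m \<open>m > 0\<close> by simp
    have sub: "S m \<subseteq> S n"
      using m by (auto simp: S_def)
    have fin: "finite (S n)"
      using less.prems by (intro finite_subset[of "S n" "{..n}"]) (auto simp: S_def dest: dvd_imp_le)
    \<comment> \<open>A prime with p^\<epsilon> < 2 lies in \<open>S n\<close> but not in
      \<open>S m\<close>, since the full power of p was removed; the drop in cardinality pays for
      its single factor \<open>K\<close>.\<close>
    have step: "real (a + 1) * K ^ card (S m) \<le> K ^ card (S n) * real (p ^ a) powr \<epsilon>"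
    proof (cases "real p powr \<epsilon> \<ge> 2")
      case True
      have "real (a + 1) * K ^ card (S m) \<le> real (p ^ a) powr \<epsilon> * K ^ card (S n)"
        using True assms \<open>p \<ge> 2\<close> K card_mono[OF fin sub]
        by (intro mult_mono Suc_le_mult_powr power_increasing) auto
      then show ?thesis by (simp add: mult.commute)
    next
      case False
      then have "p \<in> S n" "p \<notin> S m"
        using p m by (auto simp: S_def)
      then have "card (S m) < card (S n)"
        using sub fin by (intro psubset_card_mono) auto
      then have "K * K ^ card (S m) \<le> K ^ card (S n)"
        using K by (subst power_Suc[symmetric], intro power_increasing) auto
      have "real (a + 1) * K ^ card (S m) \<le> (K * real (p ^ a) powr \<epsilon>) * K ^ card (S m)"
        unfolding K_def using assms \<open>p \<ge> 2\<close> K[unfolded K_def]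
        by (intro mult_right_mono Suc_le_mult_powr) auto
      also have "\<dots> = real (p ^ a) powr \<epsilon> * (K * K ^ card (S m))"
        by simp
      also have "\<dots> \<le> real (p ^ a) powr \<epsilon> * K ^ card (S n)"
        using \<open>K * K ^ card (S m) \<le> K ^ card (S n)\<close> by (intro mult_left_mono) auto
      finally show ?thesis by (simp add: mult.commute)
    qed
    have "real (divisor_count n) \<le> real ((a + 1) * divisor_count m)"
      unfolding m(1) by (intro of_nat_mono divisor_count_prime_power_mult p \<open>m > 0\<close>)
    also have "\<dots> = real (a + 1) * real (divisor_count m)"
      by (simp only: of_nat_mult)
    also have "\<dots> \<le> real (a + 1) * (K ^ card (S m) * real m powr \<epsilon>)"
      unfolding K_def by (intro mult_left_mono less.IH \<open>m > 0\<close> \<open>m < n\<close>) auto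
    also have "\<dots> = (real (a + 1) * K ^ card (S m)) * real m powr \<epsilon>"
      by simp
    also have "\<dots> \<le> (K ^ card (S n) * real (p ^ a) powr \<epsilon>) * real m powr \<epsilon>"
      by (intro mult_right_mono step) auto
    also have "\<dots> = K ^ card (S n) * real n powr \<epsilon>"
      by (simp add: m(1) powr_mult)
    finally show ?thesis unfolding K_def .
  qed
qed

lemma divisor_count_le_powr:
  fixes \<epsilon> :: real
  assumes "\<epsilon> > 0"
  shows "\<exists>C\<ge>1. \<forall>n>0. real (divisor_count n) \<le> C * real n powr \<epsilon>"
proof -
  define K where "K = 1 + 1 / (\<epsilon> * ln 2)"
  have K: "K \<ge> 1"
    using assms by (simp add: K_def)
  define P where "P = {p::nat. real p powr \<epsilon> < 2}"
  have "P \<subseteq> {..nat \<lceil>2 powr (1 / \<epsilon>)\<rceil>}"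
  proof
    fix p assume "p \<in> P"
    then have "(real p powr \<epsilon>) powr (1 / \<epsilon>) \<le> 2 powr (1 / \<epsilon>)"
      using assms by (intro powr_mono2) (auto simp: P_def)
    then have "real p \<le> 2 powr (1 / \<epsilon>)"
      using assms by (simp add: powr_powr)
    then show "p \<in> {..nat \<lceil>2 powr (1 / \<epsilon>)\<rceil>}"
      by simp linarith
  qed
  then have P: "finite P"
    by (rule finite_subset) auto
  have "real (divisor_count n) \<le> K ^ card P * real n powr \<epsilon>" if "n > 0" for n
  proof -
    have "real (divisor_count n) \<le>
        K ^ card {p. prime p \<and> p dvd n \<and> real p powr \<epsilon> < 2} * real n powr \<epsilon>"
      unfolding K_def using assms that by (rule divisor_count_le_powr_aux)
    also have "\<dots> \<le> K ^ card P * real n powr \<epsilon>"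
      using K by (intro mult_right_mono power_increasing card_mono P) (auto simp: P_def)
    finally show ?thesis .
  qed
  moreover have "K ^ card P \<ge> 1"
    using K by simp
  ultimately show ?thesis by blast
qed

subsection \<open>Points of the lattice \<open>a = r b\<close> modulo \<open>q\<close>\<close>

definition lat_box :: "nat \<Rightarrow> int \<Rightarrow> nat \<Rightarrow> (int \<times> int) set" where
  "lat_box q r H = {(a, b). \<bar>a\<bar> \<le> int H \<and> \<bar>b\<bar> \<le> int H \<and> int q dvd a - r * b}"

text \<open>The first minimum of the lattice in the sup norm. For q > 0 the vector (q, 0) is a
  lattice point, so the minimum is attained and is at most q.\<close>

definition lat_min :: "nat \<Rightarrow> int \<Rightarrow> nat" where
  "lat_min q r = (LEAST n. \<exists>a b. (a, b) \<noteq> (0, 0) \<and> int q dvd a - r * b \<and> n = nat (max \<bar>a\<bar> \<bar>b\<bar>))"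

lemma lat_min_attained:
  assumes "q > 0"
  obtains a b where "(a, b) \<noteq> (0, 0)" "int q dvd a - r * b" "int (lat_min q r) = max \<bar>a\<bar> \<bar>b\<bar>"
proof -
  have "\<exists>a b. (a, b) \<noteq> (0, 0) \<and> int q dvd a - r * b \<and> lat_min q r = nat (max \<bar>a\<bar> \<bar>b\<bar>)"
    unfolding lat_min_def
    by (rule LeastI[of _ q], rule exI[of _ "int q"], rule exI[of _ 0]) (use assms in auto)
  then obtain a b where ab: "(a, b) \<noteq> (0, 0)" "int q dvd a - r * b" "lat_min q r = nat (max \<bar>a\<bar> \<bar>b\<bar>)"
    by blast
  then have "int (lat_min q r) = max \<bar>a\<bar> \<bar>b\<bar>"
    by simp
  with ab show ?thesis using that by blast
qed

lemma lat_min_le: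
  assumes "(a, b) \<noteq> (0, 0)" "int q dvd a - r * b"
  shows "int (lat_min q r) \<le> max \<bar>a\<bar> \<bar>b\<bar>"
proof -
  have "lat_min q r \<le> nat (max \<bar>a\<bar> \<bar>b\<bar>)"
    unfolding lat_min_def by (rule Least_le) (use assms in blast)
  then show ?thesis by linarith
qed

lemma lat_min_pos: "q > 0 \<Longrightarrow> lat_min q r > 0"
  by (erule lat_min_attained[of q r]) (simp, linarith)

lemma lat_min_le_modulus: "q > 0 \<Longrightarrow> lat_min q r \<le> q"
  using lat_min_le[of "int q" 0 q r] by auto

lemma finite_lat_box: "finite (lat_box q r H)"
  by (rule finite_subset[of _ "{- int H..int H} \<times> {- int H..int H}"]) (auto simp: lat_box_def)

lemma lat_box_trivial:
  assumes "H < lat_min q r"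
  shows "lat_box q r H = {(0, 0)}"
proof -
  have "v = (0, 0)" if "v \<in> lat_box q r H" for v
  proof (rule ccontr)
    assume "v \<noteq> (0, 0)"
    obtain a b where v: "v = (a, b)" by (cases v)
    have "int (lat_min q r) \<le> max \<bar>a\<bar> \<bar>b\<bar>"
      using that \<open>v \<noteq> (0, 0)\<close> by (intro lat_min_le) (auto simp: v lat_box_def)
    moreover have "max \<bar>a\<bar> \<bar>b\<bar> \<le> int H"
      using that by (auto simp: v lat_box_def)
    ultimately show False
      using assms by linarith
  qed
  then show ?thesis by (auto simp: lat_box_def)
qed

text \<open>The determinant of two lattice vectors is a multiple of \<open>q\<close>, so the box is covered by
  few lines parallel to a shortest vector, and on each line the points are \<open>lat_min\<close>-separated.\<close>

lemma card_lat_box_le: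
  assumes "q > 0" and H: "lat_min q r \<le> H"
  shows "real (card (lat_box q r H)) \<le> 3 * real H / real (lat_min q r) + 12 * real H ^ 2 / real q"
proof -
  define m where "m = int (lat_min q r)"
  obtain a0 b0 where v0: "(a0, b0) \<noteq> (0, 0)" "int q dvd a0 - r * b0" "m = max \<bar>a0\<bar> \<bar>b0\<bar>"
    using lat_min_attained[OF \<open>q > 0\<close>, of r] unfolding m_def by metis
  have m: "m > 0" "m \<le> int H"
    using lat_min_pos[OF \<open>q > 0\<close>, of r] H by (auto simp: m_def)
  \<comment> \<open>\<open>D\<close> is the determinant with the shortest vector and indexes the
    line parallel to it. Along such a line the coordinate \<open>g\<close>, in which the shortest
    vector attains its norm \<open>m\<close>, dominates the other, so two points in one cell of
    length \<open>m\<close> differ by a vector shorter than the minimum and coincide.\<close>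
  define D where "D = (\<lambda>(a, b). a0 * b - a * b0)"
  define g :: "int \<times> int \<Rightarrow> int" where "g = (\<lambda>(a, b). if \<bar>a0\<bar> = m then a else b)"
  define k where "k = 2 * m * int H div int q"
  define F where "F = (\<lambda>v. (D v div int q, (g v + int H) div m))"
  have D_dvd: "int q dvd D v" if "v \<in> lat_box q r H" for v
  proof -
    obtain a b where v: "v = (a, b)" by (cases v)
    have "D v = (a0 - r * b0) * b - (a - r * b) * b0"
      by (simp add: D_def v algebra_simps)
    then show ?thesis
      using that v0(2) by (auto simp: lat_box_def v intro!: dvd_diff dvd_mult2)
  qed
  have inj: "inj_on F (lat_box q r H)"
  proof (rule inj_onI)
    fix v w assume vw: "v \<in> lat_box q r H" "w \<in> lat_box q r H" "F v = F w"
    obtain a b where v: "v = (a, b)" by (cases v)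
    obtain c d where w: "w = (c, d)" by (cases w)
    have "D v = D w"
      using vw D_dvd[of v] D_dvd[of w] \<open>q > 0\<close> by (auto simp: F_def)
    then have *: "a0 * (b - d) = (a - c) * b0"
      by (simp add: D_def v w algebra_simps)
    have "\<bar>g v - g w\<bar> < m"
    proof -
      have "(g v + int H) div m = (g w + int H) div m"
        using vw by (simp add: F_def)
      moreover have "g v + int H = m * ((g v + int H) div m) + (g v + int H) mod m"
        "g w + int H = m * ((g w + int H) div m) + (g w + int H) mod m" by simp_all
      moreover have "0 \<le> (g v + int H) mod m" "(g v + int H) mod m < m"
        "0 \<le> (g w + int H) mod m" "(g w + int H) mod m < m" using m by auto
      ultimately show ?thesis by (smt (verit))
    qed
    have le: "\<bar>a0\<bar> \<le> m" "\<bar>b0\<bar> \<le> m"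
      using v0 by auto
    have "max \<bar>a - c\<bar> \<bar>b - d\<bar> < m"
    proof (cases "\<bar>a0\<bar> = m")
      case True
      then have "\<bar>a - c\<bar> < m"
        using \<open>\<bar>g v - g w\<bar> < m\<close> by (simp add: g_def v w)
      moreover have "m * \<bar>b - d\<bar> = \<bar>a - c\<bar> * \<bar>b0\<bar>"
        using * True by (metis abs_mult)
      then have "m * \<bar>b - d\<bar> \<le> m * \<bar>a - c\<bar>"
        using le by (metis abs_ge_zero mult.commute mult_left_mono)
      then have "\<bar>b - d\<bar> \<le> \<bar>a - c\<bar>"
        using m by simp
      ultimately show ?thesis by simp
    next
      case False
      then have "\<bar>b0\<bar> = m"
        using v0 by linarith
      have "\<bar>b - d\<bar> < m"
        using \<open>\<bar>g v - g w\<bar> < m\<close> False by (simp add: g_def v w)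
      moreover have "\<bar>a0\<bar> * \<bar>b - d\<bar> = \<bar>a - c\<bar> * m"
        using * \<open>\<bar>b0\<bar> = m\<close> by (metis abs_mult)
      then have "\<bar>a - c\<bar> * m \<le> \<bar>b - d\<bar> * m"
        using le by (metis abs_ge_zero mult.commute mult_left_mono)
      then have "\<bar>a - c\<bar> \<le> \<bar>b - d\<bar>"
        using m by simp
      ultimately show ?thesis by simp
    qed
    moreover have "int q dvd (a - c) - r * (b - d)"
    proof -
      have "int q dvd a - r * b" "int q dvd c - r * d"
        using vw by (auto simp: lat_box_def v w)
      then have "int q dvd (a - r * b) - (c - r * d)"
        by (rule dvd_diff)
      then show ?thesis by (simp add: algebra_simps)
    qed
    ultimately have "(a - c, b - d) = (0, 0)"
      using lat_min_le[of "a - c" "b - d" q r] unfolding m_def by (meson not_less)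
    then show "v = w"
      by (simp add: v w)
  qed
  have "F v \<in> {-k..k} \<times> {0..2 * int H div m}" if "v \<in> lat_box q r H" for v
  proof -
    obtain a b where v: "v = (a, b)" by (cases v)
    have ab: "\<bar>a\<bar> \<le> int H" "\<bar>b\<bar> \<le> int H"
      using that by (auto simp: lat_box_def v)
    have "int q dvd D v"
      using that by (rule D_dvd)
    then obtain t where t: "D v = int q * t" ..
    have "\<bar>a0 * b\<bar> \<le> m * int H" "\<bar>a * b0\<bar> \<le> int H * m"
      using ab v0 by (auto simp: abs_mult intro!: mult_mono)
    then have "\<bar>D v\<bar> \<le> m * int H + int H * m"
      unfolding D_def v prod.case by linarith
    also have "\<dots> = 2 * m * int H"
      by simp
    finally have "\<bar>D v\<bar> \<le> 2 * m * int H" .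
    then have "\<bar>t\<bar> * int q \<le> 2 * m * int H"
      using \<open>q > 0\<close> by (simp add: t abs_mult mult.commute)
    then have "\<bar>t\<bar> \<le> k"
      using \<open>q > 0\<close> zdiv_mono1[of "\<bar>t\<bar> * int q" "2 * m * int H" "int q"] by (simp add: k_def)
    moreover have "0 \<le> g v + int H" "g v + int H \<le> 2 * int H"
      using ab by (auto simp: g_def v)
    ultimately show ?thesis
      using m t \<open>q > 0\<close> by (auto simp: F_def pos_imp_zdiv_nonneg_iff intro: zdiv_mono1)
  qed
  then have "F ` lat_box q r H \<subseteq> {-k..k} \<times> {0..2 * int H div m}"
    by (rule image_subsetI)
  then have "card (lat_box q r H) \<le> card ({-k..k} \<times> {0..2 * int H div m})"
    by (intro card_inj_on_le[OF inj]) auto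
  also have "\<dots> = nat (2 * k + 1) * nat (2 * int H div m + 1)"
    by (simp add: card_cartesian_product)
  finally have "real (card (lat_box q r H)) \<le> real (nat (2 * k + 1) * nat (2 * int H div m + 1))"
    by (rule of_nat_mono)
  also have "\<dots> = (2 * of_int k + 1) * (of_int (2 * int H div m) + 1)"
  proof -
    have "0 \<le> k" "0 \<le> 2 * int H div m"
      using m by (auto simp: k_def pos_imp_zdiv_nonneg_iff \<open>q > 0\<close>)
    then show ?thesis by simp
  qed
  also have "\<dots> \<le> (2 * (2 * real_of_int m * H / q) + 1) * (2 * real H / real_of_int m + 1)"
  proof -
    have "of_int k \<le> 2 * real_of_int m * H / q"
      using real_of_int_div4[of "2 * m * int H" "int q"] by (simp add: k_def)
    moreover have "of_int (2 * int H div m) \<le> 2 * real H / real_of_int m"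
      using real_of_int_div4[of "2 * int H" m] by simp
    moreover have "0 \<le> k" "0 \<le> 2 * int H div m"
      using m by (auto simp: k_def pos_imp_zdiv_nonneg_iff \<open>q > 0\<close>)
    ultimately show ?thesis by (intro mult_mono add_mono) auto
  qed
  \<comment> \<open>\<open>m \<le> H\<close> absorbs the added 1 into the multiple of H / m.\<close>
  also have "\<dots> \<le> (2 * (2 * real_of_int m * H / q) + 1) * (3 * real H / real_of_int m)"
    using m by (intro mult_left_mono) (auto simp: field_simps)
  also have "\<dots> = 3 * real H / real_of_int m + 12 * real H ^ 2 / real q"
    using m \<open>q > 0\<close> by (simp add: field_simps power2_eq_square)
  finally show ?thesis by (simp add: m_def)
qed

text \<open>A square shell of sup norm k has O(k) points, so the weights 1/k^2 add up to a harmonic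
  sum. Covering the shell by its four full sides gives 4 (2 k + 1) \<le> 12 k.\<close>

lemma sum_inverse_max_norm_sq_le:
  "(\<Sum>(a, b)\<in>{- int q..int q} \<times> {- int q..int q} - {(0, 0)}. 1 / real_of_int (max \<bar>a\<bar> \<bar>b\<bar>) ^ 2)
     \<le> 12 * harm q"
proof -
  define B where "B = {- int q..int q} \<times> {- int q..int q} - {(0, 0)}"
  define mx where "mx = (\<lambda>(a, b). nat (max \<bar>a\<bar> \<bar>b\<bar>) :: nat)"
  have shell: "card {v \<in> B. mx v = k} \<le> 12 * k" if "k > 0" for k
  proof -
    have "{v \<in> B. mx v = k} \<subseteq>
        {int k, - int k} \<times> {- int k..int k} \<union> {- int k..int k} \<times> {int k, - int k}"
    proof
      fix v assume v: "v \<in> {v \<in> B. mx v = k}"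
      obtain a b where ab: "v = (a, b)" by (cases v)
      have "max \<bar>a\<bar> \<bar>b\<bar> = int k"
        using v by (auto simp: mx_def ab)
      then have "(a = int k \<or> a = - int k) \<and> - int k \<le> b \<and> b \<le> int k \<or>
          (b = int k \<or> b = - int k) \<and> - int k \<le> a \<and> a \<le> int k"
        by linarith
      then show "v \<in> {int k, - int k} \<times> {- int k..int k} \<union> {- int k..int k} \<times> {int k, - int k}"
        unfolding ab by (simp; blast)
    qed
    then have "card {v \<in> B. mx v = k} \<le>
        card ({int k, - int k} \<times> {- int k..int k} \<union> {- int k..int k} \<times> {int k, - int k})"
      by (rule card_mono[rotated]) simp
    also have "\<dots> \<le> 2 * (2 * k + 1) + (2 * k + 1) * 2"
    proof (rule order.trans[OF card_Un_le], rule add_mono)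
      have 2: "card {int k, - int k} \<le> 2"
        by (simp add: card_insert_if)
      have n: "card {- int k..int k} = 2 * k + 1"
        by simp
      show "card ({int k, - int k} \<times> {- int k..int k}) \<le> 2 * (2 * k + 1)"
        unfolding card_cartesian_product n by (intro mult_right_mono 2) auto
      show "card ({- int k..int k} \<times> {int k, - int k}) \<le> (2 * k + 1) * 2"
        unfolding card_cartesian_product n by (intro mult_left_mono 2) auto
    qed
    also have "\<dots> \<le> 12 * k"
      using that by simp
    finally show ?thesis .
  qed
  have "finite B"
    by (simp add: B_def)
  have "mx ` B \<subseteq> {1..q}"
    by (auto simp: mx_def B_def)
  have "(\<Sum>(a, b)\<in>B. 1 / real_of_int (max \<bar>a\<bar> \<bar>b\<bar>) ^ 2) = (\<Sum>v\<in>B. 1 / real (mx v) ^ 2)"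
    by (intro sum.cong) (auto simp: mx_def)
  also have "\<dots> = (\<Sum>k\<in>{1..q}. \<Sum>v\<in>{v \<in> B. mx v = k}. 1 / real (mx v) ^ 2)"
    by (rule sum.group[symmetric]) (use \<open>finite B\<close> \<open>mx ` B \<subseteq> {1..q}\<close> in auto)
  also have "\<dots> = (\<Sum>k\<in>{1..q}. real (card {v \<in> B. mx v = k}) * (1 / real k ^ 2))"
    by (intro sum.cong) auto
  also have "\<dots> \<le> (\<Sum>k\<in>{1..q}. real (12 * k) * (1 / real k ^ 2))"
    by (intro sum_mono mult_right_mono of_nat_mono shell) auto
  also have "\<dots> = 12 * harm q"
    by (auto simp: harm_def sum_distrib_left power2_eq_square field_simps intro!: sum.cong)
  finally show ?thesis unfolding B_def .
qed

text \<open>With g = gcd b q, a solution is determined modulo q / g, so the quotient by q / g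
  separates the solutions in [0, q).\<close>

lemma card_mult_congruence_le:
  fixes a b :: int
  assumes "q > 0"
  shows "card {r \<in> {0..<int q}. int q dvd a - r * b} \<le> nat (gcd b (int q))"
proof -
  define g where "g = gcd b (int q)"
  have "g > 0"
    using assms by (simp add: g_def)
  obtain m where m: "int q = g * m"
    unfolding g_def by (meson gcd_dvd2 dvdE)
  have "m > 0"
    using assms m \<open>g > 0\<close> by (metis of_nat_0_less_iff zero_less_mult_pos)
  obtain b' where b': "b = g * b'"
    unfolding g_def by (meson gcd_dvd1 dvdE)
  have cop: "coprime m b'"
  proof -
    have "g * gcd b' m = gcd (g * b') (g * m)"
      using \<open>g > 0\<close> gcd_mult_distrib_int[of g b' m] by simp
    also have "\<dots> = g * 1"
      by (simp only: m[symmetric] b'[symmetric]) (simp add: g_def)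
    finally have "g * gcd b' m = g * 1" .
    then show ?thesis
      using \<open>g > 0\<close> by (simp add: coprime_iff_gcd_eq_1 gcd.commute)
  qed
  have "inj_on (\<lambda>r. r div m) {r \<in> {0..<int q}. int q dvd a - r * b}"
  proof (rule inj_onI)
    fix r s assume *: "r \<in> {r \<in> {0..<int q}. int q dvd a - r * b}"
      "s \<in> {r \<in> {0..<int q}. int q dvd a - r * b}" "r div m = s div m"
    have "int q dvd (a - r * b) - (a - s * b)"
      using * by (intro dvd_diff[of "int q" "a - r * b"]) auto
    also have "(a - r * b) - (a - s * b) = g * (b' * (s - r))"
      by (simp add: b' algebra_simps)
    finally have "m dvd b' * (s - r)"
      using \<open>g > 0\<close> by (simp add: m)
    then have "m dvd s - r"
      using cop by (simp add: coprime_dvd_mult_right_iff)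
    then have "s mod m = r mod m"
      by (simp add: mod_eq_dvd_iff)
    then show "r = s"
      using * by (metis div_mult_mod_eq)
  qed
  moreover have "(\<lambda>r. r div m) ` {r \<in> {0..<int q}. int q dvd a - r * b} \<subseteq> {0..<g}"
  proof safe
    fix r assume "r \<in> {0..<int q}"
    then have r: "0 \<le> r" "r < m * g"
      by (auto simp: m mult.commute)
    have "m * (r div m) \<le> r"
      using \<open>m > 0\<close> by (metis mult.commute div_mod_decomp_int le_add_same_cancel1 pos_mod_sign)
    then have "m * (r div m) < m * g"
      using r by linarith
    then show "r div m \<in> {0..<g}"
      using r \<open>m > 0\<close> by (simp add: pos_imp_zdiv_nonneg_iff)
  qed
  ultimately have "card {r \<in> {0..<int q}. int q dvd a - r * b} \<le> card {0..<g}"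
    by (intro card_inj_on_le[of "\<lambda>r. r div m"]) auto
  then show ?thesis by (simp add: g_def)
qed

text \<open>Each r is charged to one of its shortest vectors (a, b). A vector is a lattice point for
  at most d = gcd b q ratios, and if there is any, then d divides a too. Hence (a, b) is d times an
  integer vector, whose weight loses d^2 against the multiplicity d: every divisor d of q
  contributes at most the full harmonic sum.\<close>

lemma sum_inverse_lat_min_sq_le:
  assumes "q > 0"
  shows "(\<Sum>r\<in>{0..<int q}. 1 / real (lat_min q r) ^ 2) \<le> 12 * real (divisor_count q) * harm q"
proof -
  define B where "B = {- int q..int q} \<times> {- int q..int q} - {(0, 0)}"
  define wt where "wt = (\<lambda>(a, b). 1 / real_of_int (max \<bar>a\<bar> \<bar>b\<bar>) ^ 2)"
  define D where "D = {d. d dvd q}"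
  have fin: "finite B" "finite D"
    using assms by (auto simp: B_def D_def)
  have wt_nonneg: "wt v \<ge> 0" for v
    by (auto simp: wt_def split: prod.splits)
  have "(\<Sum>r\<in>{0..<int q}. 1 / real (lat_min q r) ^ 2)
      \<le> (\<Sum>r\<in>{0..<int q}. \<Sum>v\<in>B. if int q dvd fst v - r * snd v then wt v else 0)"
  proof (rule sum_mono)
    fix r
    obtain a b where v: "(a, b) \<noteq> (0, 0)" "int q dvd a - r * b" "int (lat_min q r) = max \<bar>a\<bar> \<bar>b\<bar>"
      using lat_min_attained[OF assms] by metis
    have "(a, b) \<in> B"
      using v lat_min_le_modulus[OF assms, of r] by (auto simp: B_def)
    have "1 / real (lat_min q r) ^ 2 = (\<lambda>v. if int q dvd fst v - r * snd v then wt v else 0) (a, b)"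
      using v(2) by (simp add: wt_def v(3)[symmetric])
    also have "\<dots> \<le> (\<Sum>v\<in>B. if int q dvd fst v - r * snd v then wt v else 0)"
      by (rule member_le_sum[OF \<open>(a, b) \<in> B\<close>]) (use wt_nonneg fin in auto)
    finally show "1 / real (lat_min q r) ^ 2 \<le> (\<Sum>v\<in>B. if int q dvd fst v - r * snd v then wt v else 0)" .
  qed
  also have "\<dots> = (\<Sum>v\<in>B. \<Sum>r\<in>{0..<int q}. if int q dvd fst v - r * snd v then wt v else 0)"
    by (rule sum.swap)
  also have "\<dots> = (\<Sum>v\<in>B. real (card {r \<in> {0..<int q}. int q dvd fst v - r * snd v}) * wt v)"
    by (intro sum.cong) (auto simp: sum.If_cases Int_def)
  also have "\<dots> \<le> (\<Sum>v\<in>B. \<Sum>d\<in>D. if int d dvd fst v \<and> int d dvd snd v then real d * wt v else 0)"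
  proof (rule sum_mono)
    fix v :: "int \<times> int"
    define g where "g = nat (gcd (snd v) (int q))"
    have g: "int g = gcd (snd v) (int q)"
      by (simp add: g_def)
    then have "int g dvd int q"
      by simp
    then have "g \<in> D"
      by (simp add: D_def)
    show "real (card {r \<in> {0..<int q}. int q dvd fst v - r * snd v}) * wt v
        \<le> (\<Sum>d\<in>D. if int d dvd fst v \<and> int d dvd snd v then real d * wt v else 0)"
    proof (cases "{r \<in> {0..<int q}. int q dvd fst v - r * snd v} = {}")
      case True
      then show ?thesis
        by (simp only: card.empty) (auto intro!: sum_nonneg wt_nonneg mult_nonneg_nonneg)
    next
      case False
      then obtain r where "int q dvd fst v - r * snd v" by auto
      then have "int g dvd (fst v - r * snd v) + r * snd v"
        using g by (intro dvd_add) (auto intro: dvd_trans)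
      then have dvd: "int g dvd fst v" "int g dvd snd v"
        using g by auto
      have "real (card {r \<in> {0..<int q}. int q dvd fst v - r * snd v}) * wt v \<le> real g * wt v"
        unfolding g_def by (intro mult_right_mono of_nat_mono card_mult_congruence_le assms wt_nonneg)
      also have "\<dots> = (\<lambda>d. if int d dvd fst v \<and> int d dvd snd v then real d * wt v else 0) g"
        using dvd by simp
      also have "\<dots> \<le> (\<Sum>d\<in>D. if int d dvd fst v \<and> int d dvd snd v then real d * wt v else 0)"
        by (rule member_le_sum[OF \<open>g \<in> D\<close>]) (use wt_nonneg fin in auto)
      finally show ?thesis .
    qed
  qed
  also have "\<dots> = (\<Sum>d\<in>D. \<Sum>v\<in>B. if int d dvd fst v \<and> int d dvd snd v then real d * wt v else 0)"
    by (rule sum.swap)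
  also have "\<dots> \<le> (\<Sum>d\<in>D. 12 * harm q)"
  proof (rule sum_mono)
    fix d assume "d \<in> D"
    then have d: "d \<ge> 1" "d dvd q"
      using assms by (auto simp: D_def Suc_le_eq intro: Nat.gr0I)
    define f where "f = (\<lambda>(a, b). (int d * a, int d * b))"
    define B' where "B' = {v \<in> B. int d dvd fst v \<and> int d dvd snd v}"
    have "(\<Sum>v\<in>B. if int d dvd fst v \<and> int d dvd snd v then real d * wt v else 0)
        = (\<Sum>v\<in>B'. real d * wt v)"
      unfolding B'_def using fin by (intro sum.mono_neutral_cong_right) auto
    also have "\<dots> \<le> (\<Sum>v\<in>f ` B. real d * wt v)"
    proof (rule sum_mono2)
      show "B' \<subseteq> f ` B"
      proof
        fix v assume v: "v \<in> B'"
        then obtain a b where ab: "v = (int d * a, int d * b)"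
          by (cases v) (auto simp: B'_def elim!: dvdE)
        have "\<bar>a\<bar> \<le> \<bar>int d * a\<bar>" "\<bar>b\<bar> \<le> \<bar>int d * b\<bar>"
          using d mult_right_mono[of 1 "int d" "\<bar>a\<bar>"] mult_right_mono[of 1 "int d" "\<bar>b\<bar>"]
          by (auto simp: abs_mult)
        then have "(a, b) \<in> B"
          using v by (auto simp: B'_def B_def ab)
        then show "v \<in> f ` B"
          by (auto simp: f_def ab intro!: rev_image_eqI)
      qed
    qed (use fin wt_nonneg in auto)
    also have "\<dots> = (\<Sum>v\<in>B. real d * wt (f v))"
      using d by (subst sum.reindex) (auto simp: inj_on_def f_def)
    also have "\<dots> \<le> (\<Sum>v\<in>B. wt v)"
    proof (rule sum_mono)
      fix v assume "v \<in> B"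
      obtain a b where v: "v = (a, b)" by (cases v)
      have "max \<bar>int d * a\<bar> \<bar>int d * b\<bar> = int d * max \<bar>a\<bar> \<bar>b\<bar>"
        by (simp add: abs_mult max_mult_distrib_left)
      then have "wt (f v) = 1 / (real d * real_of_int (max \<bar>a\<bar> \<bar>b\<bar>)) ^ 2"
        by (simp only: f_def v wt_def prod.case of_int_mult of_int_of_nat_eq)
      then have "real d * wt (f v) = wt v / real d"
        using d by (simp only: v wt_def prod.case power2_eq_square) (simp add: field_simps)
      also have "\<dots> \<le> wt v"
        using d wt_nonneg[of v] mult_left_mono[of 1 "real d" "wt v"] by (simp add: divide_le_eq)
      finally show "real d * wt (f v) \<le> wt v" .
    qed
    also have "\<dots> \<le> 12 * harm q"
      unfolding wt_def B_def by (rule sum_inverse_max_norm_sq_le)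
    finally show "(\<Sum>v\<in>B. if int d dvd fst v \<and> int d dvd snd v then real d * wt v else 0) \<le> 12 * harm q" .
  qed
  also have "\<dots> = 12 * real (divisor_count q) * harm q"
    by (simp add: D_def divisor_count_def)
  finally show ?thesis .
qed

subsection \<open>Coincidences among ratios\<close>

text \<open>\<open>Z\<close> collects every factor that is bounded by a power of \<open>q\<close> with arbitrarily small
  exponent.\<close>

locale loss =
  fixes q :: nat and Z :: real
  assumes q2: "q \<ge> 2"
    and divisor_count_le: "\<And>n. 0 < n \<Longrightarrow> n \<le> 4 * q ^ 4 \<Longrightarrow> real (divisor_count n) \<le> Z"
    and ln_le: "1 + ln (real q) \<le> Z"
begin

abbreviation inv_mod :: "int \<Rightarrow> int" where
  "inv_mod x \<equiv> modular_inverse (int q) x"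

lemma q_pos: "q > 0"
  using q2 by simp

lemma Z_ge_1: "Z \<ge> 1"
  using ln_le q2 ln_ge_zero[of "real q"] by linarith

lemma inv_mod_cong: "coprime x (int q) \<Longrightarrow> [x * inv_mod x = 1] (mod int q)"
  by (rule cong_modular_inverse1)

lemma coprime_nonzero: "coprime x (int q) \<Longrightarrow> x \<noteq> 0"
  using q2 by auto

lemma sum_inverse_lat_min_sq_le_Z:
  "(\<Sum>r\<in>{0..<int q}. 1 / real (lat_min q r) ^ 2) \<le> 12 * Z ^ 2"
proof -
  have "(\<Sum>r\<in>{0..<int q}. 1 / real (lat_min q r) ^ 2) \<le> 12 * real (divisor_count q) * harm q"
    using q_pos by (rule sum_inverse_lat_min_sq_le)
  also have "\<dots> \<le> 12 * Z * Z"
  proof (intro mult_mono)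
    have "q \<le> 4 * q ^ 4"
      using self_le_power[of q 4] q2 by linarith
    then show "real (divisor_count q) \<le> Z"
      using q_pos by (intro divisor_count_le)
    \<comment> \<open>\<open>harm n - ln n\<close> is decreasing and equals 1 at n = 1.\<close>
    show "harm q \<le> Z"
      using euler_mascheroni_sequence_decreasing[of 1 q] q_pos ln_le by (simp add: harm_def)
  qed (use Z_ge_1 in \<open>auto intro: harm_nonneg\<close>)
  finally show ?thesis
    by (simp add: power2_eq_square)
qed

text \<open>With \<open>\<lambda> = lat_min q r\<close>: ratios \<open>r\<close> with \<open>\<lambda> > X\<close> do not occur; if
  \<open>L < \<lambda> \<le> X\<close> then \<open>r\<close> has at most one representation from \<open>A\<close>, and there are at most
  \<open>L\<^sup>2\<close> such \<open>r\<close>.\<close>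

lemma ratio_energy_le_aux:
  fixes A B :: "int set" and L X :: nat and u :: int
  assumes A: "A \<subseteq> {u + 1..u + int L}" "\<And>l. l \<in> A \<Longrightarrow> coprime l (int q)"
    and B: "B \<subseteq> {- int X..int X}" "\<And>x. x \<in> B \<Longrightarrow> coprime x (int q)"
    and L: "L \<ge> 1"
  shows "(\<Sum>r\<in>{0..<int q}. real (card {(l, l') \<in> A \<times> A. int q dvd l - r * l'}) *
            real (card {(x, x') \<in> B \<times> B. int q dvd x - r * x'}))
         \<le> 1200 * Z ^ 2 * (real L * real X + real L ^ 2 * real X ^ 2 / real q)"
proof -
  define P where "P = (\<lambda>r. {(l, l') \<in> A \<times> A. int q dvd l - r * l'})"
  define Q where "Q = (\<lambda>r. {(x, x') \<in> B \<times> B. int q dvd x - r * x'})"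
  define m where "m = lat_min q"
  have fin: "finite A" "finite B"
    using A(1) B(1) by (auto intro: finite_subset)
  have finP: "finite (P r)" and finQ: "finite (Q r)" for r
    by (rule finite_subset[of _ "A \<times> A"], auto simp: P_def fin)
       (rule finite_subset[of _ "B \<times> B"], auto simp: Q_def fin)
  have m_pos: "m r > 0" for r
    unfolding m_def using q_pos by (rule lat_min_pos)
  \<comment> \<open>The interval of \<open>A\<close> may lie far from the origin; subtracting one
    fixed solution moves all of them into a box centred at 0.\<close>
  have P_le: "card (P r) \<le> card (lat_box q r L)" for r
  proof (cases "P r = {}")
    case False
    then obtain a b where ab: "(a, b) \<in> P r" by fast
    show ?thesis
    proof (rule card_inj_on_le[of "\<lambda>(c, d). (c - a, d - b)"])
      show "(\<lambda>(c, d). (c - a, d - b)) ` P r \<subseteq> lat_box q r L"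
      proof safe
        fix c d assume cd: "(c, d) \<in> P r"
        have "int q dvd c - r * d" "int q dvd a - r * b"
          using ab cd by (auto simp: P_def)
        then have "int q dvd (c - r * d) - (a - r * b)"
          by (rule dvd_diff)
        moreover have "a \<in> {u + 1..u + int L}" "b \<in> {u + 1..u + int L}"
            "c \<in> {u + 1..u + int L}" "d \<in> {u + 1..u + int L}"
          using ab cd A(1) by (auto simp: P_def)
        ultimately show "(c - a, d - b) \<in> lat_box q r L"
          by (auto simp: lat_box_def algebra_simps)
      qed
    qed (auto simp: inj_on_def finite_lat_box)
  qed auto
  have Q_sub: "Q r \<subseteq> lat_box q r X" for r
    using B(1) by (fastforce simp: Q_def lat_box_def)
  have Q_le: "card (Q r) \<le> card (lat_box q r X)" for r
    by (intro card_mono finite_lat_box Q_sub)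
  have Q_empty: "Q r = {}" if "X < m r" for r
  proof -
    have "Q r \<subseteq> lat_box q r X"
      by (rule Q_sub)
    also have "\<dots> = {(0, 0)}"
      using that unfolding m_def by (rule lat_box_trivial)
    finally show ?thesis
      using B(2) coprime_nonzero by (auto simp: Q_def)
  qed
  have P_le_1: "card (P r) \<le> 1" if "L < m r" for r
    using P_le[of r] lat_box_trivial[of L q r] that by (simp add: m_def)
  have P_box: "real (card (P r)) \<le> 3 * L / m r + 12 * real L ^ 2 / q" if "m r \<le> L" for r
    using P_le[of r] card_lat_box_le[OF q_pos, of r L] that unfolding m_def by linarith
  have Q_box: "real (card (Q r)) \<le> 3 * X / m r + 12 * real X ^ 2 / q" if "m r \<le> X" for r
    using Q_le[of r] card_lat_box_le[OF q_pos, of r X] that unfolding m_def by linarith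
  define R1 where "R1 = {r \<in> {0..<int q}. m r \<le> L \<and> m r \<le> X}"
  define R2 where "R2 = {r \<in> {0..<int q}. L < m r \<and> m r \<le> X \<and> P r \<noteq> {}}"
  \<comment> \<open>A pair (l, l') determines r modulo q because l' is invertible, so choosing one
    pair for each ratio is injective.\<close>
  have card_R2: "card R2 \<le> L ^ 2"
  proof -
    define f where "f = (\<lambda>r. SOME v. v \<in> P r)"
    have f: "f r \<in> P r" if "r \<in> R2" for r
      using that unfolding f_def R2_def by (auto intro: someI)
    have "inj_on f R2"
    proof (rule inj_onI)
      fix r s assume rs: "r \<in> R2" "s \<in> R2" "f r = f s"
      obtain l l' where l: "f r = (l, l')" by (cases "f r")
      have *: "int q dvd l - r * l'" "int q dvd l - s * l'" "l' \<in> A"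
        using f[OF rs(1)] f[OF rs(2)] l rs(3) by (auto simp: P_def)
      have "int q dvd (l - r * l') - (l - s * l')"
        using *(1,2) by (rule dvd_diff)
      also have "(l - r * l') - (l - s * l') = (s - r) * l'"
        by (simp add: algebra_simps)
      finally have "int q dvd s - r"
        using A(2)[OF *(3)] by (simp add: coprime_dvd_mult_left_iff coprime_commute)
      then have "s mod int q = r mod int q"
        by (simp add: mod_eq_dvd_iff)
      then show "r = s"
        using rs by (auto simp: R2_def)
    qed
    moreover have "f ` R2 \<subseteq> A \<times> A"
      using f by (fastforce simp: P_def)
    ultimately have "card R2 \<le> card (A \<times> A)"
      using fin by (intro card_inj_on_le) auto
    also have "\<dots> \<le> L * L"
      unfolding card_cartesian_product
      using card_mono[OF _ A(1)] by (intro mult_mono) auto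
    finally show ?thesis by (simp add: power2_eq_square)
  qed
  define s where "s = (\<Sum>r\<in>{0..<int q}. 1 / real (m r) ^ 2)"
  have s: "s \<le> 12 * Z ^ 2"
    unfolding s_def m_def by (rule sum_inverse_lat_min_sq_le_Z)
  have s_R1: "(\<Sum>r\<in>R1. 1 / real (m r) ^ 2) \<le> s"
    unfolding s_def R1_def by (rule sum_mono2) auto
  have bound1: "(\<Sum>r\<in>R1. real (card (P r)) * real (card (Q r)))
      \<le> (9 * L * X + 72 * real L ^ 2 * real X ^ 2 / q) * s + 144 * real L ^ 2 * real X ^ 2 / q"
  proof -
    have "real (card (P r)) * real (card (Q r)) \<le>
        (9 * L * X + 72 * real L ^ 2 * real X ^ 2 / q) * (1 / real (m r) ^ 2)
          + 144 * real L ^ 2 * real X ^ 2 / q * (1 / q)" if "r \<in> R1" for r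
    proof -
      define l where "l = real (m r)"
      have l: "0 < l" "l \<le> L" "l \<le> X"
        using that m_pos[of r] by (auto simp: R1_def l_def)
      have "real (card (P r)) * real (card (Q r))
          \<le> (3 * L / l + 12 * real L ^ 2 / q) * (3 * X / l + 12 * real X ^ 2 / q)"
        unfolding l_def using that by (intro mult_mono P_box Q_box) (auto simp: R1_def)
      also have "\<dots> = 9 * L * X * (1 / l ^ 2) + 36 * real L * real X * X / q * (1 / l)
          + 36 * real L * real L * real X / q * (1 / l) + 144 * real L ^ 2 * real X ^ 2 / q * (1 / q)"
        using l q_pos by (simp add: field_simps power2_eq_square)
      \<comment> \<open>The cross terms carry only 1 / l. On \<open>R1\<close> the minimum l is at
        most L and X, so 1 / l is at most L / l^2 and X / l^2, and everything but the last term
        acquires the summable weight; the last term carries 1 / q and is summed over at most q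
        ratios.\<close>
      also have "36 * real L * real X * X / q * (1 / l) \<le> 36 * real L * real X * X / q * (L * (1 / l ^ 2))"
        using l by (intro mult_left_mono) (auto simp: field_simps power2_eq_square)
      also have "36 * real L * real L * real X / q * (1 / l) \<le> 36 * real L * real L * real X / q * (X * (1 / l ^ 2))"
        using l by (intro mult_left_mono) (auto simp: field_simps power2_eq_square)
      finally show ?thesis
        by (simp add: l_def algebra_simps power2_eq_square add_divide_distrib)
    qed
    then have "(\<Sum>r\<in>R1. real (card (P r)) * real (card (Q r)))
        \<le> (\<Sum>r\<in>R1. (9 * L * X + 72 * real L ^ 2 * real X ^ 2 / q) * (1 / real (m r) ^ 2)
          + 144 * real L ^ 2 * real X ^ 2 / q * (1 / q))"
      by (rule sum_mono)
    also have "\<dots> = (9 * L * X + 72 * real L ^ 2 * real X ^ 2 / q) * (\<Sum>r\<in>R1. 1 / real (m r) ^ 2)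
          + 144 * real L ^ 2 * real X ^ 2 / q * (real (card R1) / q)"
      by (simp add: sum.distrib sum_distrib_left)
    also have "\<dots> \<le> (9 * L * X + 72 * real L ^ 2 * real X ^ 2 / q) * s
          + 144 * real L ^ 2 * real X ^ 2 / q * 1"
    proof (intro add_mono mult_left_mono s_R1)
      have "card R1 \<le> card {0..<int q}"
        unfolding R1_def by (rule card_mono) auto
      then show "real (card R1) / q \<le> 1"
        using q_pos by (simp add: divide_le_eq)
    qed auto
    finally show ?thesis by simp
  qed
  have bound2: "(\<Sum>r\<in>R2. real (card (P r)) * real (card (Q r)))
      \<le> 3 * L * X + 12 * real L ^ 2 * real X ^ 2 / q"
  proof -
    \<comment> \<open>\<open>lat_min\<close> exceeds L here, so X / \<open>lat_min\<close> is at
      most X / L; over L^2 ratios this costs only L X.\<close>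
    have "real (card (P r)) * real (card (Q r)) \<le> 1 * (3 * X / L + 12 * real X ^ 2 / q)" if "r \<in> R2" for r
    proof (intro mult_mono)
      show "real (card (P r)) \<le> 1"
        using P_le_1[of r] that by (simp add: R2_def)
      have "real (card (Q r)) \<le> 3 * X / m r + 12 * real X ^ 2 / q"
        using that by (intro Q_box) (simp add: R2_def)
      also have "3 * X / m r \<le> 3 * real X / L"
        using that L by (auto simp: R2_def intro!: divide_left_mono)
      finally show "real (card (Q r)) \<le> 3 * X / L + 12 * real X ^ 2 / q" by simp
    qed auto
    then have "(\<Sum>r\<in>R2. real (card (P r)) * real (card (Q r))) \<le> card R2 * (1 * (3 * X / L + 12 * real X ^ 2 / q))"
      by (intro order.trans[OF sum_bounded_above]) auto
    also have "\<dots> \<le> real (L ^ 2) * (1 * (3 * X / L + 12 * real X ^ 2 / q))"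
      by (intro mult_right_mono of_nat_mono card_R2) auto
    also have "\<dots> = 3 * L * X + 12 * real L ^ 2 * real X ^ 2 / q"
      using L by (simp add: field_simps power2_eq_square)
    finally show ?thesis .
  qed
  have "(\<Sum>r\<in>{0..<int q}. real (card (P r)) * real (card (Q r)))
      = (\<Sum>r\<in>R1 \<union> R2. real (card (P r)) * real (card (Q r)))"
  proof (rule sum.mono_neutral_right)
    show "\<forall>r\<in>{0..<int q} - (R1 \<union> R2). real (card (P r)) * real (card (Q r)) = 0"
    proof
      fix r assume r: "r \<in> {0..<int q} - (R1 \<union> R2)"
      show "real (card (P r)) * real (card (Q r)) = 0"
      proof (cases "X < m r")
        case False
        then have "P r = {}"
          using r by (auto simp: R1_def R2_def)
        then show ?thesis by simp
      qed (simp add: Q_empty)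
    qed
    show "finite {0..<int q}" by simp
  qed (auto simp: R1_def R2_def)
  also have "\<dots> = (\<Sum>r\<in>R1. real (card (P r)) * real (card (Q r))) + (\<Sum>r\<in>R2. real (card (P r)) * real (card (Q r)))"
  proof (rule sum.union_disjoint)
    show "finite R1" "finite R2"
      by (rule finite_subset[of _ "{0..<int q}"], auto simp: R1_def R2_def)+
  qed (auto simp: R1_def R2_def)
  also have "\<dots> \<le> ((9 * L * X + 72 * real L ^ 2 * real X ^ 2 / q) * (12 * Z ^ 2) + 144 * real L ^ 2 * real X ^ 2 / q)
      + (3 * L * X + 12 * real L ^ 2 * real X ^ 2 / q)"
    by (intro add_mono order.trans[OF bound1] bound2 mult_left_mono s) auto
  \<comment> \<open>The coefficients are 9 * 12 + 3 = 111 and at most 72 * 12 + 144 + 12 =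
    1020.\<close>
  also have "\<dots> \<le> 1200 * Z ^ 2 * (real L * real X + real L ^ 2 * real X ^ 2 / q)"
  proof -
    define a b where "a = real L * real X" and "b = real L ^ 2 * real X ^ 2 / q"
    have "a \<ge> 0" "b \<ge> 0" "Z ^ 2 \<ge> 1"
      using Z_ge_1 by (auto simp: a_def b_def)
    then have "a * 1 \<le> a * Z ^ 2" "b * 1 \<le> b * Z ^ 2"
      by (intro mult_left_mono; simp)+
    moreover have "a * Z ^ 2 \<ge> 0" "b * Z ^ 2 \<ge> 0"
      using \<open>a \<ge> 0\<close> \<open>b \<ge> 0\<close> by simp_all
    ultimately have "((9 * a + 72 * b) * (12 * Z ^ 2) + 144 * b) + (3 * a + 12 * b) \<le> 1200 * Z ^ 2 * (a + b)"
      by (simp add: algebra_simps)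
    then show ?thesis
      by (simp add: a_def b_def mult.assoc)
  qed
  finally show ?thesis
    by (simp add: P_def Q_def)
qed

text \<open>The squared fibre sizes count quadruples with l/x = l'/x'. Cross-multiplication gives
  l/l' = x/x' = r, and for fixed r the pairs (l, l') and (x, x') are independent. The regrouping map
  is injective because c is recovered from l and x.\<close>

lemma ratio_energy_le:
  fixes A B :: "int set" and L X :: nat and u :: int
  assumes A: "A \<subseteq> {u + 1..u + int L}" "\<And>l. l \<in> A \<Longrightarrow> coprime l (int q)"
    and B: "B \<subseteq> {- int X..int X}" "\<And>x. x \<in> B \<Longrightarrow> coprime x (int q)"
    and L: "L \<ge> 1"
  shows "(\<Sum>c\<in>{0..<int q}. real (card {(l, x) \<in> A \<times> B. l * inv_mod x mod int q = c}) ^ 2)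
         \<le> 1200 * Z ^ 2 * (real L * real X + real L ^ 2 * real X ^ 2 / real q)"
proof -
  define F where "F = (\<lambda>c. {(l, x) \<in> A \<times> B. l * inv_mod x mod int q = c})"
  define P where "P = (\<lambda>r. {(l, l') \<in> A \<times> A. int q dvd l - r * l'})"
  define Q where "Q = (\<lambda>r. {(x, x') \<in> B \<times> B. int q dvd x - r * x'})"
  have fin: "finite A" "finite B"
    using A(1) B(1) by (auto intro: finite_subset)
  have finF: "finite (F c)" and finP: "finite (P c)" and finQ: "finite (Q c)" for c
    by (rule finite_subset[of _ "A \<times> B"], auto simp: F_def fin)
       (rule finite_subset[of _ "A \<times> A"], auto simp: P_def fin,
        rule finite_subset[of _ "B \<times> B"], auto simp: Q_def fin)
  define S where "S = (SIGMA c:{0..<int q}. F c \<times> F c)"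
  define S' where "S' = (SIGMA r:{0..<int q}. P r \<times> Q r)"
  define g where "g = (\<lambda>(c :: int, (l :: int, x), (l' :: int, x')).
      (x * inv_mod x' mod int q, (l, l'), (x, x')))"
  have "card S \<le> card S'"
  proof (rule card_inj_on_le[of g])
    show "inj_on g S"
      by (rule inj_onI) (auto simp: g_def S_def F_def)
    show "g ` S \<subseteq> S'"
    proof (rule image_subsetI)
      fix v assume "v \<in> S"
      obtain c l x l' x' where v: "v = (c, (l, x), (l', x'))"
        by (cases v) auto
      have *: "l \<in> A" "l' \<in> A" "x \<in> B" "x' \<in> B"
          "l * inv_mod x mod int q = l' * inv_mod x' mod int q"
        using \<open>v \<in> S\<close> by (auto simp: v S_def F_def)
      define r where "r = x * inv_mod x' mod int q"
      have r: "[r = x * inv_mod x'] (mod int q)"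
        by (simp add: r_def cong_def)
      have "[r * x' = x * inv_mod x' * x'] (mod int q)"
        by (intro cong_mult r cong_refl)
      also have "x * inv_mod x' * x' = x * (x' * inv_mod x')"
        by simp
      also have "[\<dots> = x * 1] (mod int q)"
        by (intro cong_mult cong_refl inv_mod_cong B(2) *)
      finally have 1: "int q dvd x - r * x'"
        by (subst dvd_diff_commute) (simp add: cong_iff_dvd_diff)
      have "[r * l' = x * inv_mod x' * l'] (mod int q)"
        by (intro cong_mult r cong_refl)
      also have "x * inv_mod x' * l' = x * (l' * inv_mod x')"
        by simp
      also have "[\<dots> = x * (l * inv_mod x)] (mod int q)"
        using *(5) by (intro cong_scalar_left) (simp add: cong_def)
      also have "x * (l * inv_mod x) = l * (x * inv_mod x)"
        by simp
      also have "[\<dots> = l * 1] (mod int q)"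
        by (intro cong_mult cong_refl inv_mod_cong B(2) *)
      finally have 2: "int q dvd l - r * l'"
        by (subst dvd_diff_commute) (simp add: cong_iff_dvd_diff)
      have "r \<in> {0..<int q}"
        using q_pos by (simp add: r_def)
      moreover have "g v = (r, (l, l'), (x, x'))"
        by (simp add: v g_def r_def)
      ultimately show "g v \<in> S'"
        using 1 2 *(1-4) by (simp add: S'_def P_def Q_def)
    qed
    show "finite S'"
      unfolding S'_def using finP finQ by (intro finite_SigmaI) auto
  qed
  then have "real (card S) \<le> real (card S')"
    by (rule of_nat_mono)
  moreover have "real (card S) = (\<Sum>c\<in>{0..<int q}. real (card (F c)) ^ 2)"
    unfolding S_def using finF by (subst card_SigmaI) (auto simp: card_cartesian_product power2_eq_square)
  moreover have "real (card S') = (\<Sum>r\<in>{0..<int q}. real (card (P r)) * real (card (Q r)))"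
    unfolding S'_def using finP finQ by (subst card_SigmaI) (auto simp: card_cartesian_product)
  moreover have "(\<Sum>r\<in>{0..<int q}. real (card (P r)) * real (card (Q r)))
      \<le> 1200 * Z ^ 2 * (real L * real X + real L ^ 2 * real X ^ 2 / real q)"
    unfolding P_def Q_def by (rule ratio_energy_le_aux[OF A B L])
  ultimately show ?thesis
    by (simp add: F_def)
qed

end

subsection \<open>Coincidences among sums of reciprocals\<close>

lemma card_int_divisors_le:
  fixes n :: int
  assumes "n \<noteq> 0"
  shows "card {d. d dvd n} \<le> 2 * divisor_count (nat \<bar>n\<bar>)"
proof -
  define D where "D = {d. d dvd nat \<bar>n\<bar>}"
  have "finite D"
    unfolding D_def by (rule finite_divisors_nat) (use assms in simp)
  have "{d. d dvd n} \<subseteq> int ` D \<union> (\<lambda>d. - int d) ` D"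
  proof
    fix d assume "d \<in> {d. d dvd n}"
    then have "nat \<bar>d\<bar> \<in> D"
      by (simp add: D_def nat_abs_dvd_iff)
    moreover have "d = int (nat \<bar>d\<bar>) \<or> d = - int (nat \<bar>d\<bar>)"
      by linarith
    ultimately show "d \<in> int ` D \<union> (\<lambda>d. - int d) ` D"
      by blast
  qed
  then have "card {d. d dvd n} \<le> card (int ` D \<union> (\<lambda>d. - int d) ` D)"
    using \<open>finite D\<close> by (intro card_mono) auto
  also have "\<dots> \<le> card D + card D"
    using \<open>finite D\<close> by (intro order.trans[OF card_Un_le] add_mono card_image_le)
  finally show ?thesis
    by (simp add: divisor_count_def D_def)
qed

context loss
begin

lemma inv_mod_cong_iff:
  assumes "coprime x (int q)" "coprime y (int q)" "inv_mod x = inv_mod y"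
  shows "x mod int q = y mod int q"
proof -
  have "[x * (y * inv_mod y) = x * 1] (mod int q)"
    by (intro cong_mult cong_refl inv_mod_cong assms)
  moreover have "[y * (x * inv_mod x) = y * 1] (mod int q)"
    by (intro cong_mult cong_refl inv_mod_cong assms)
  ultimately show ?thesis
    using assms(3) by (simp add: cong_def mult.left_commute)
qed

definition recip_pairs :: "int set \<Rightarrow> int \<Rightarrow> (int \<times> int) set" where
  "recip_pairs B c = {(x, y) \<in> B \<times> B. (inv_mod x + inv_mod y) mod int q = c}"

lemma recip_pairs_cong:
  assumes "(x, y) \<in> recip_pairs B c" "coprime x (int q)" "coprime y (int q)"
  shows "int q dvd c * (x * y) - (x + y)"
proof -
  have "[c = inv_mod x + inv_mod y] (mod int q)"
    using assms(1) by (auto simp: recip_pairs_def cong_def)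
  then have "[c * (x * y) = (inv_mod x + inv_mod y) * (x * y)] (mod int q)"
    by (rule cong_mult) simp
  also have "(inv_mod x + inv_mod y) * (x * y) = (x * inv_mod x) * y + (y * inv_mod y) * x"
    by (simp add: algebra_simps)
  also have "[\<dots> = 1 * y + 1 * x] (mod int q)"
    by (intro cong_add cong_mult cong_refl inv_mod_cong assms)
  finally show ?thesis
    by (simp add: cong_iff_dvd_diff algebra_simps)
qed

text \<open>Makes the degenerate cases cheap: a vanishing factor in the divisor argument, and the
  class c = 0, fix one coordinate in terms of the other.\<close>

lemma recip_pairs_snd_unique:
  assumes "(x, y) \<in> recip_pairs B c" "(x, z) \<in> recip_pairs B c"
    and "\<And>x. x \<in> B \<Longrightarrow> coprime x (int q)" "inj_on (\<lambda>x. x mod int q) B"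
  shows "y = z"
proof -
  have "(inv_mod x + inv_mod y) mod int q = (inv_mod x + inv_mod z) mod int q"
    using assms by (auto simp: recip_pairs_def)
  then have "int q dvd inv_mod y - inv_mod z"
    by (simp add: mod_eq_dvd_iff)
  then have "inv_mod y mod int q = inv_mod z mod int q"
    by (simp add: mod_eq_dvd_iff)
  then have "inv_mod y = inv_mod z"
    using modular_inverse_int_less modular_inverse_int_nonneg q_pos by simp
  then have "y mod int q = z mod int q"
    using assms by (intro inv_mod_cong_iff) (auto simp: recip_pairs_def)
  then show ?thesis
    using assms by (auto simp: recip_pairs_def dest: inj_onD)
qed

lemma recip_pairs_sym: "(x, y) \<in> recip_pairs B c \<Longrightarrow> (y, x) \<in> recip_pairs B c"
  by (auto simp: recip_pairs_def add.commute)

text \<open>Dirichlet's theorem yields \<open>k \<le> K\<close> with \<open>a = k c - h q\<close> small, and then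
  \<open>c x y \<equiv> x + y\<close> becomes \<open>(a x - k) (a y - k) = k\<^sup>2 + a q t\<close> with few values of \<open>t\<close>.\<close>

lemma card_recip_pairs_le:
  fixes B :: "int set" and Y K :: nat
  assumes B: "B \<subseteq> {- int Y..int Y}" "\<And>x. x \<in> B \<Longrightarrow> coprime x (int q)"
      "inj_on (\<lambda>x. x mod int q) B"
    and Y: "Y \<le> q" and K: "0 < K" "K < q"
    and c: "\<And>k. 0 < k \<Longrightarrow> k \<le> int K \<Longrightarrow> \<not> int q dvd k * c"
  shows "real (card (recip_pairs B c)) \<le> 2 * Z * (1 + 2 * real Y ^ 2 / K + 4 * real K * real Y / q)"
proof -
  obtain h k where hk: "0 < k" "k \<le> int K" "\<bar>of_int k * (of_int c / real q) - of_int h\<bar> < 1 / real K"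
    using Dirichlet_approx[OF K(1)] by metis
  define a where "a = k * c - h * int q"
  \<comment> \<open>Admissibility of \<open>K\<close> enters here: with a = 0 the equation below
    would be linear in x and y, and the divisor bound would have nothing to factor.\<close>
  have "a \<noteq> 0"
  proof
    assume "a = 0"
    then have "int q dvd k * c"
      by (simp add: a_def)
    then show False
      using c hk by blast
  qed
  have a_less: "\<bar>real_of_int a\<bar> < real q / K"
  proof -
    have "real_of_int a = (of_int k * (of_int c / real q) - of_int h) * real q"
      using q_pos by (simp add: a_def field_simps)
    then have "\<bar>real_of_int a\<bar> = \<bar>of_int k * (of_int c / real q) - of_int h\<bar> * real q"
      by (simp only: abs_mult)
    also have "\<dots> < 1 / real K * real q"
      using hk q_pos by (intro mult_strict_right_mono) auto
    finally show ?thesis by simp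
  qed
  \<comment> \<open>Bound for the multiplier t: a x y contributes at most (q / K) Y^2 and k (x + y)
    at most 2 K Y, both divided by q.\<close>
  define T where "T = real Y ^ 2 / K + 2 * real K * real Y / q"
  have "T \<ge> 0"
    by (simp add: T_def)
  have abs_le: "\<bar>x\<bar> \<le> int Y" if "x \<in> B" for x
    using that B(1) by (fastforce simp: abs_le_iff)
  define fib where "fib = (\<lambda>t. {(x, y) \<in> recip_pairs B c. a * (x * y) - k * (x + y) = int q * t})"
  have finB: "finite B"
    using B(1) by (rule finite_subset) auto
  have fin: "finite (recip_pairs B c)"
    by (rule finite_subset[of _ "B \<times> B"]) (auto simp: recip_pairs_def finB)
  then have fin_fib: "finite (fib t)" for t
    by (rule rev_finite_subset) (auto simp: fib_def)
  have cover: "recip_pairs B c \<subseteq> (\<Union>t\<in>{-\<lfloor>T\<rfloor>..\<lfloor>T\<rfloor>}. fib t)"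
  proof
    fix v assume v: "v \<in> recip_pairs B c"
    obtain x y where xy: "v = (x, y)" by (cases v)
    have in_B: "x \<in> B" "y \<in> B"
      using v by (auto simp: recip_pairs_def xy)
    have "int q dvd k * (c * (x * y) - (x + y)) - int q * (h * (x * y))"
      using recip_pairs_cong[of x y B c] v in_B B(2) by (intro dvd_diff) (auto simp: xy)
    also have "k * (c * (x * y) - (x + y)) - int q * (h * (x * y)) = a * (x * y) - k * (x + y)"
      by (simp add: a_def algebra_simps)
    finally obtain t where t: "a * (x * y) - k * (x + y) = int q * t" ..
    have "real q * \<bar>real_of_int t\<bar> = \<bar>real_of_int (a * (x * y) - k * (x + y))\<bar>"
      unfolding t by (simp add: abs_mult)
    also have "\<dots> \<le> \<bar>real_of_int a\<bar> * (\<bar>real_of_int x\<bar> * \<bar>real_of_int y\<bar>) + \<bar>real_of_int k\<bar> * (\<bar>real_of_int x\<bar> + \<bar>real_of_int y\<bar>)"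
    proof -
      have "\<bar>real_of_int (a * (x * y) - k * (x + y))\<bar> \<le> \<bar>real_of_int (a * (x * y))\<bar> + \<bar>real_of_int (k * (x + y))\<bar>"
        by simp
      also have "\<bar>real_of_int (k * (x + y))\<bar> \<le> \<bar>real_of_int k\<bar> * (\<bar>real_of_int x\<bar> + \<bar>real_of_int y\<bar>)"
        by (simp only: of_int_mult of_int_add abs_mult) (intro mult_left_mono abs_triangle_ineq; simp)
      finally show ?thesis by (simp add: abs_mult)
    qed
    also have "\<dots> \<le> (real q / K) * (real Y * real Y) + real K * (real Y + real Y)"
    proof (intro add_mono mult_mono)
      show "\<bar>real_of_int x\<bar> \<le> real Y" "\<bar>real_of_int y\<bar> \<le> real Y" "\<bar>real_of_int x\<bar> \<le> real Y" "\<bar>real_of_int y\<bar> \<le> real Y"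
        using abs_le[OF in_B(1)] abs_le[OF in_B(2)] by linarith+
      show "\<bar>real_of_int k\<bar> \<le> real K"
        using hk by linarith
    qed (use a_less in auto)
    also have "\<dots> = real q * T"
      using q_pos by (simp add: T_def field_simps power2_eq_square)
    finally have "\<bar>real_of_int t\<bar> \<le> T"
      using q_pos by simp
    then have "t \<in> {-\<lfloor>T\<rfloor>..\<lfloor>T\<rfloor>}"
      by (auto simp: le_floor_iff abs_le_iff minus_le_iff)
    moreover have "v \<in> fib t"
      using v t by (simp add: fib_def xy)
    ultimately show "v \<in> (\<Union>t\<in>{-\<lfloor>T\<rfloor>..\<lfloor>T\<rfloor>}. fib t)" by blast
  qed
  have fib_le: "real (card (fib t)) \<le> 2 * Z" for t
  proof -
    define n where "n = k ^ 2 + a * int q * t"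
    have n: "(a * x - k) * (a * y - k) = n" if "(x, y) \<in> fib t" for x y
    proof -
      have "(a * x - k) * (a * y - k) = k ^ 2 + a * (a * (x * y) - k * (x + y))"
        by (simp add: algebra_simps power2_eq_square)
      also have "a * (x * y) - k * (x + y) = int q * t"
        using that by (simp add: fib_def)
      finally show ?thesis
        by (simp add: n_def)
    qed
    show ?thesis
    proof (cases "n = 0 \<or> fib t = {}")
      case False
      then obtain x0 y0 where xy0: "(x0, y0) \<in> fib t" by fastforce
      have "\<bar>a\<bar> \<le> int q"
      proof -
        have "real q / K \<le> real q / 1"
          using K by (intro divide_left_mono) auto
        then show ?thesis
          using a_less by linarith
      qed
      have factor: "\<bar>a * x - k\<bar> \<le> 2 * int q ^ 2" if "x \<in> B" for x
      proof -
        have "\<bar>a * x - k\<bar> \<le> \<bar>a\<bar> * \<bar>x\<bar> + \<bar>k\<bar>"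
          by (simp add: abs_mult[symmetric])
        also have "\<dots> \<le> int q * int q + int q"
          using \<open>\<bar>a\<bar> \<le> int q\<close> abs_le[OF that] Y hk K by (intro add_mono mult_mono) auto
        also have "\<dots> \<le> 2 * int q ^ 2"
          using q_pos by (simp add: power2_eq_square)
        finally show ?thesis .
      qed
      have "\<bar>n\<bar> = \<bar>a * x0 - k\<bar> * \<bar>a * y0 - k\<bar>"
        using n[OF xy0] by (simp add: abs_mult[symmetric])
      \<comment> \<open>This product is the source of the range 4 q^4 for the divisor bound in
        \<open>loss\<close>.\<close>
      also have "\<dots> \<le> (2 * int q ^ 2) * (2 * int q ^ 2)"
        using xy0 by (intro mult_mono factor) (auto simp: fib_def recip_pairs_def)
      also have "\<dots> = int (4 * q ^ 4)"
        by (simp add: power_add[symmetric])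
      finally have "nat \<bar>n\<bar> \<le> 4 * q ^ 4"
        by linarith
      have "card (fib t) \<le> card {d. d dvd n}"
      proof (rule card_inj_on_le[of "\<lambda>(x, y). a * x - k"])
        show "inj_on (\<lambda>(x, y). a * x - k) (fib t)"
        proof (rule inj_onI, safe)
          fix x y x' y' assume *: "(x, y) \<in> fib t" "(x', y') \<in> fib t" "a * x - k = a * x' - k"
          then show "x = x'"
            using \<open>a \<noteq> 0\<close> by simp
          have "a * x - k \<noteq> 0"
            using n[OF *(1)] False by auto
          moreover have "(a * x - k) * (a * y - k) = (a * x - k) * (a * y' - k)"
            unfolding n[OF *(1)] unfolding *(3) n[OF *(2)] ..
          ultimately have "a * y = a * y'" by simp
          then show "y = y'"
            using \<open>a \<noteq> 0\<close> by simp
        qed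
        show "(\<lambda>(x, y). a * x - k) ` fib t \<subseteq> {d. d dvd n}"
          using n by (auto intro: dvdI[OF sym])
        show "finite {d. d dvd n}"
          using False by simp
      qed
      also have "\<dots> \<le> 2 * divisor_count (nat \<bar>n\<bar>)"
        using False by (intro card_int_divisors_le) auto
      finally have "real (card (fib t)) \<le> 2 * real (divisor_count (nat \<bar>n\<bar>))"
        by linarith
      also have "\<dots> \<le> 2 * Z"
        using False \<open>nat \<bar>n\<bar> \<le> 4 * q ^ 4\<close> by (intro mult_left_mono divisor_count_le) auto
      finally show ?thesis .
    next
      case True
      \<comment> \<open>If n = 0, one of the factors a x - k, a y - k vanishes. As a is nonzero this
        fixes one coordinate and hence the pair, which leaves at most two pairs.\<close>
      define F1 where "F1 = {(x, y) \<in> recip_pairs B c. a * x = k}"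
      define F2 where "F2 = {(x, y) \<in> recip_pairs B c. a * y = k}"
      have "v \<in> F1 \<union> F2" if "v \<in> fib t" for v
      proof -
        obtain x y where v: "v = (x, y)" by (cases v)
        have "n = 0"
          using True that by blast
        then have "a * x = k \<or> a * y = k"
          using n[of x y] that by (simp add: v)
        then show ?thesis
          using that by (auto simp: v fib_def F1_def F2_def)
      qed
      then have "fib t \<subseteq> F1 \<union> F2" by blast
      moreover have "card F1 \<le> Suc 0"
      proof (rule card_le_Suc0_iff_eq[THEN iffD2])
        show "finite F1"
          using fin by (rule rev_finite_subset) (auto simp: F1_def)
        show "\<forall>v\<in>F1. \<forall>w\<in>F1. v = w"
          using \<open>a \<noteq> 0\<close> recip_pairs_snd_unique[OF _ _ B(2,3)] by (fastforce simp: F1_def)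
      qed
      moreover have "card F2 \<le> Suc 0"
      proof (rule card_le_Suc0_iff_eq[THEN iffD2])
        show "finite F2"
          using fin by (rule rev_finite_subset) (auto simp: F2_def)
        show "\<forall>v\<in>F2. \<forall>w\<in>F2. v = w"
          using \<open>a \<noteq> 0\<close> recip_pairs_snd_unique[OF recip_pairs_sym recip_pairs_sym B(2,3)]
          by (fastforce simp: F2_def)
      qed
      moreover have "finite (F1 \<union> F2)"
        using fin by (rule rev_finite_subset) (auto simp: F1_def F2_def)
      ultimately have "card (fib t) \<le> 2"
        using card_mono[of "F1 \<union> F2" "fib t"] card_Un_le[of F1 F2] by linarith
      then show ?thesis
        using Z_ge_1 by linarith
    qed
  qed
  have "card (recip_pairs B c) \<le> card (\<Union>t\<in>{-\<lfloor>T\<rfloor>..\<lfloor>T\<rfloor>}. fib t)"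
    using cover fin_fib by (intro card_mono) auto
  also have "\<dots> \<le> (\<Sum>t\<in>{-\<lfloor>T\<rfloor>..\<lfloor>T\<rfloor>}. card (fib t))"
    by (rule card_UN_le) auto
  finally have "real (card (recip_pairs B c)) \<le> real (\<Sum>t\<in>{-\<lfloor>T\<rfloor>..\<lfloor>T\<rfloor>}. card (fib t))"
    by (rule of_nat_mono)
  also have "\<dots> = (\<Sum>t\<in>{-\<lfloor>T\<rfloor>..\<lfloor>T\<rfloor>}. real (card (fib t)))"
    by simp
  also have "\<dots> \<le> (\<Sum>t\<in>{-\<lfloor>T\<rfloor>..\<lfloor>T\<rfloor>}. 2 * Z)"
    by (rule sum_mono) (rule fib_le)
  also have "\<dots> = real_of_int (2 * \<lfloor>T\<rfloor> + 1) * (2 * Z)"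
    using \<open>T \<ge> 0\<close> by simp
  also have "\<dots> \<le> (2 * T + 1) * (2 * Z)"
    using Z_ge_1 by (intro mult_right_mono) auto
  also have "\<dots> = 2 * Z * (1 + 2 * real Y ^ 2 / K + 4 * real K * real Y / q)"
    by (simp add: T_def algebra_simps)
  finally show ?thesis .
qed

text \<open>For each x the nonzero multiple x + y of d takes at most 4 Y / d values. Admitting x + y
  = 0 would add a term of order Y, which dominates once d exceeds Y.\<close>

lemma card_gcd_pairs_le:
  fixes B :: "int set" and Y d :: nat
  assumes B: "B \<subseteq> {- int Y..int Y}" "0 \<notin> B" and d: "d > 0"
  shows "real (card {(x, y) \<in> B \<times> B. int d dvd x + y \<and> x + y \<noteq> 0}) \<le> 8 * real Y ^ 2 / d"
proof -
  define k where "k = 2 * int Y div int d"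
  have "k \<ge> 0"
    using d by (simp add: k_def pos_imp_zdiv_nonneg_iff)
  have "finite B"
    using B(1) by (rule finite_subset) auto
  have "B \<subseteq> {- int Y..int Y} - {0}"
    using B by auto
  then have "card B \<le> card ({- int Y..int Y} - {0})"
    by (intro card_mono) auto
  then have card_B: "card B \<le> 2 * Y"
    by simp
  have "card {(x, y) \<in> B \<times> B. int d dvd x + y \<and> x + y \<noteq> 0} \<le> card (B \<times> ({-k..k} - {0}))"
  proof (rule card_inj_on_le[of "\<lambda>(x, y). (x, (x + y) div int d)"])
    show "inj_on (\<lambda>(x, y). (x, (x + y) div int d)) {(x, y) \<in> B \<times> B. int d dvd x + y \<and> x + y \<noteq> 0}"
      using d by (auto intro!: inj_onI)
    show "(\<lambda>(x, y). (x, (x + y) div int d)) ` {(x, y) \<in> B \<times> B. int d dvd x + y \<and> x + y \<noteq> 0}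
        \<subseteq> B \<times> ({-k..k} - {0})"
    proof (safe)
      fix x y assume xy: "x \<in> B" "y \<in> B" "int d dvd x + y" "x + y \<noteq> 0"
      obtain t where t: "x + y = int d * t"
        using xy by blast
      have "- int Y \<le> x \<and> x \<le> int Y" "- int Y \<le> y \<and> y \<le> int Y"
        using xy B(1) by auto
      then have "\<bar>x + y\<bar> \<le> 2 * int Y"
        by linarith
      then have "\<bar>t\<bar> * int d \<le> 2 * int Y"
        by (simp add: t abs_mult mult.commute)
      then have "\<bar>t\<bar> \<le> k"
        using zdiv_mono1[of "\<bar>t\<bar> * int d" "2 * int Y" "int d"] d by (simp add: k_def)
      then show "(x + y) div int d \<in> {-k..k}"
        using d by (auto simp: t)
      show "(x + y) div int d = 0 \<Longrightarrow> False"
        using d xy t by simp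
    qed
  qed (use \<open>finite B\<close> in auto)
  also have "\<dots> \<le> (2 * Y) * (2 * nat k)"
    unfolding card_cartesian_product using \<open>k \<ge> 0\<close> card_B by (intro mult_mono) (auto simp: card_Diff_singleton)
  finally have "real (card {(x, y) \<in> B \<times> B. int d dvd x + y \<and> x + y \<noteq> 0}) \<le> real ((2 * Y) * (2 * nat k))"
    by (rule of_nat_mono)
  also have "\<dots> = 4 * real Y * of_int k"
    using \<open>k \<ge> 0\<close> by simp
  also have "\<dots> \<le> 4 * real Y * (2 * real Y / d)"
    using real_of_int_div4[of "2 * int Y" "int d"] by (intro mult_left_mono) (auto simp: k_def)
  finally show ?thesis
    by (simp add: power2_eq_square)
qed

text \<open>Turns a common divisor of c and q into a divisor of x + y, by reading c x y = x + y
  modulo d. The value x + y = 0 would force q to divide c, since x y is a unit.\<close>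

lemma recip_pairs_gcd_subset:
  assumes B: "\<And>x. x \<in> B \<Longrightarrow> coprime x (int q)" and d: "int d dvd int q"
  shows "(\<Union>c\<in>{c \<in> {1..<int q}. gcd c (int q) = int d}. recip_pairs B c)
    \<subseteq> {(x, y) \<in> B \<times> B. int d dvd x + y \<and> x + y \<noteq> 0}"
proof safe
  fix x y c assume c: "c \<in> {1..<int q}" "gcd c (int q) = int d" and xy: "(x, y) \<in> recip_pairs B c"
  show in_B: "x \<in> B" "y \<in> B"
    using xy by (auto simp: recip_pairs_def)
  have *: "int q dvd c * (x * y) - (x + y)"
    using xy in_B B by (intro recip_pairs_cong) auto
  then have "int d dvd c * (x * y) - (x + y)"
    using d by (rule dvd_trans[rotated])
  moreover have "int d dvd c * (x * y)"
    using c(2) by (metis dvd_mult2 gcd_dvd1)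
  ultimately have "int d dvd c * (x * y) - (c * (x * y) - (x + y))"
    by (rule dvd_diff[rotated])
  then show "int d dvd x + y" by simp
  assume "x + y = 0"
  then have "int q dvd c * (x * y)"
    using * by simp
  moreover have "coprime (x * y) (int q)"
    using in_B B by simp
  ultimately have "int q dvd c"
    by (simp add: coprime_dvd_mult_left_iff coprime_commute)
  then show False
    using c(1) by (auto dest: zdvd_imp_le)
qed

text \<open>Write \<open>w = sqrt (Y / q)\<close>, so that \<open>sqrt (q Y) = q w\<close> and \<open>Y = q w\<^sup>2\<close>. For classes \<open>c\<close>
  with a large common divisor \<open>q / m\<close> with \<open>q\<close>, the choice \<open>K = q w\<close> is not admissible, but then
  there are few pairs.\<close>

lemma sum_recip_pairs_gcd_le:
  fixes B :: "int set" and Y d :: nat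
  assumes B: "B \<subseteq> {- int Y..int Y}" "\<And>x. x \<in> B \<Longrightarrow> coprime x (int q)"
      "inj_on (\<lambda>x. x mod int q) B"
    and Y: "1 \<le> Y" "Y \<le> q" and d: "d dvd q" "d < q"
  shows "(\<Sum>c\<in>{c \<in> {1..<int q}. gcd c (int q) = int d}. real (card (recip_pairs B c)) ^ 2)
    \<le> 16 * Z * (real Y ^ 2 + 14 * real Y ^ 3 * sqrt (real Y / real q))"
proof -
  define C where "C = {c \<in> {1..<int q}. gcd c (int q) = int d}"
  obtain m where m: "q = d * m"
    using d(1) by blast
  have "d > 0"
    using d q_pos by (intro Nat.gr0I) auto
  have "m \<ge> 2"
  proof (rule ccontr)
    assume "\<not> m \<ge> 2"
    then have "m = 0 \<or> m = 1" by linarith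
    then show False
      using m q_pos d(2) by auto
  qed
  define w where "w = sqrt (real Y / real q)"
  have w: "w > 0" "w \<le> 1" "real Y = real q * w ^ 2"
    using Y q_pos by (auto simp: w_def)
  have "real q * w \<ge> 1"
  proof -
    have "(real q * w) ^ 2 = real q * real Y"
      using w by (simp add: power2_eq_square)
    also have "\<dots> \<ge> 1 * 1"
      using Y q_pos by (intro mult_mono) auto
    finally show ?thesis
      using w q_pos by (intro power2_le_imp_le[of 1]) auto
  qed
  \<comment> \<open>q w = sqrt (q Y) balances Y^2 / K against K Y / q in
    \<open>card_recip_pairs_le\<close>. The cap m - 1, with m = q / d, guarantees that q divides no
    k c with 0 < k \<le> K when gcd c q = d.\<close>
  define K where "K = min (m - 1) (nat \<lceil>real q * w\<rceil>)"
  have K: "1 \<le> K" "K < m" "real K \<le> m" "real K \<le> 2 * (real q * w)"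
    using \<open>m \<ge> 2\<close> \<open>real q * w \<ge> 1\<close> by (auto simp: K_def min_le_iff_disj) linarith+
  \<comment> \<open>1 / (m - 1) is at most 2 / m because m \<ge> 2; the sum covers both values of
    the minimum at once.\<close>
  have "1 / real K \<le> 2 / m + 1 / (real q * w)"
  proof (cases "m - 1 \<le> nat \<lceil>real q * w\<rceil>")
    case True
    then have "real K = real m - 1"
      using \<open>m \<ge> 2\<close> by (simp add: K_def min_def of_nat_diff)
    then have "1 / real K \<le> 2 / m"
      using \<open>m \<ge> 2\<close> by (simp add: field_simps)
    also have "\<dots> \<le> 2 / m + 1 / (real q * w)"
      using w by simp
    finally show ?thesis .
  next
    case False
    then have "real K \<ge> real q * w"
      by (simp add: K_def min_def) linarith
    then have "1 / real K \<le> 1 / (real q * w)"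
      using \<open>real q * w \<ge> 1\<close> by (intro divide_left_mono) auto
    also have "\<dots> \<le> 2 / m + 1 / (real q * w)"
      by simp
    finally show ?thesis .
  qed
  note K_inv = this
  have "m \<le> q"
    using m \<open>d > 0\<close> by simp
  define R where "R = 2 * Z * (1 + 2 * real Y ^ 2 / K + 4 * real K * real Y / q)"
  have "R \<ge> 0"
    using Z_ge_1 by (auto simp: R_def)
  have R: "real (card (recip_pairs B c)) \<le> R" if "c \<in> C" for c
    unfolding R_def
  proof (rule card_recip_pairs_le[OF B Y(2)])
    show "0 < K" "K < q"
      using K \<open>m \<le> q\<close> by auto
    fix k assume k: "0 < k" "k \<le> int K"
    show "\<not> int q dvd k * c"
    proof
      assume "int q dvd k * c"
      have c: "gcd c (int q) = int d"
        using that by (simp add: C_def)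
      then obtain c' where c': "c = int d * c'"
        by (metis gcd_dvd1 dvdE)
      have "int d * gcd c' (int m) = int d * 1"
        using gcd_mult_distrib_int[of "int d" c' "int m"] c by (simp add: c' m)
      then have "coprime c' (int m)"
        using \<open>d > 0\<close> by (simp add: coprime_iff_gcd_eq_1)
      have "int d * int m dvd int d * (k * c')"
        using \<open>int q dvd k * c\<close> by (simp add: m c' mult.left_commute)
      then have "int m dvd k * c'"
        using \<open>d > 0\<close> by simp
      then have "int m dvd k"
        using \<open>coprime c' (int m)\<close> by (simp add: coprime_dvd_mult_left_iff coprime_commute)
      then have "int m \<le> k"
        using k(1) by (rule zdvd_imp_le)
      then show False
        using k K by linarith
    qed
  qed
  have finB: "finite B"
    using B(1) by (rule finite_subset) auto
  have fin: "finite (recip_pairs B c)" for c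
    by (rule finite_subset[of _ "B \<times> B"]) (auto simp: recip_pairs_def finB)
  have "finite C"
    by (rule finite_subset[of _ "{1..<int q}"]) (auto simp: C_def)
  have "(\<Sum>c\<in>C. card (recip_pairs B c)) = card (\<Union>c\<in>C. recip_pairs B c)"
    using \<open>finite C\<close> fin by (subst card_UN_disjoint) (auto simp: recip_pairs_def)
  also have "\<dots> \<le> card {(x, y) \<in> B \<times> B. int d dvd x + y \<and> x + y \<noteq> 0}"
  proof (rule card_mono)
    show "finite {(x, y) \<in> B \<times> B. int d dvd x + y \<and> x + y \<noteq> 0}"
      by (rule finite_subset[of _ "B \<times> B"]) (auto simp: finB)
    show "(\<Union>c\<in>C. recip_pairs B c) \<subseteq> {(x, y) \<in> B \<times> B. int d dvd x + y \<and> x + y \<noteq> 0}"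
      unfolding C_def using B(2) d(1) by (intro recip_pairs_gcd_subset) auto
  qed
  finally have "real (\<Sum>c\<in>C. card (recip_pairs B c)) \<le> real (card {(x, y) \<in> B \<times> B. int d dvd x + y \<and> x + y \<noteq> 0})"
    by (rule of_nat_mono)
  also have "\<dots> \<le> 8 * real Y ^ 2 / d"
    using B(1,2) coprime_nonzero \<open>d > 0\<close> by (intro card_gcd_pairs_le) auto
  also have "\<dots> = 8 * real Y ^ 2 * (real m / real q)"
    using \<open>d > 0\<close> \<open>m \<ge> 2\<close> by (simp add: m)
  finally have count: "(\<Sum>c\<in>C. real (card (recip_pairs B c))) \<le> 8 * real Y ^ 2 * (real m / real q)"
    by simp
  \<comment> \<open>The second moment is at most the maximum times the first moment. A small m
    spoils the maximum through Y^2 / m, but the first moment carries the factor m / q, and m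
    cancels.\<close>
  have "(\<Sum>c\<in>C. real (card (recip_pairs B c)) ^ 2) \<le> (\<Sum>c\<in>C. R * real (card (recip_pairs B c)))"
    unfolding power2_eq_square by (intro sum_mono mult_right_mono R) auto
  also have "\<dots> = R * (\<Sum>c\<in>C. real (card (recip_pairs B c)))"
    by (simp add: sum_distrib_left)
  also have "\<dots> \<le> R * (8 * real Y ^ 2 * (real m / real q))"
    by (intro mult_left_mono count \<open>R \<ge> 0\<close>)
  also have "\<dots> = 16 * Z * (real Y ^ 2 * ((real m / real q) * (1 + 2 * real Y ^ 2 * (1 / K) + 4 * real K * real Y / q)))"
    by (simp add: R_def)
  also have "\<dots> \<le> 16 * Z * (real Y ^ 2 * (1 + 14 * real Y * w))"
  proof (intro mult_left_mono)
    define \<mu> where "\<mu> = real m / real q"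
    have \<mu>: "0 < \<mu>" "\<mu> \<le> 1" "real m = real q * \<mu>"
      using \<open>m \<le> q\<close> \<open>m \<ge> 2\<close> q_pos by (auto simp: \<mu>_def)
    have "\<mu> * (1 + 2 * real Y ^ 2 * (1 / K) + 4 * real K * real Y / q)
        \<le> \<mu> * (1 + 2 * real Y ^ 2 * (2 / m + 1 / (real q * w)) + 4 * (2 * (real q * w)) * real Y / q)"
      using \<mu> K_inv K by (intro mult_left_mono add_mono divide_right_mono mult_right_mono) auto
    \<comment> \<open>With Y / q = w^2, the term in 2 / m becomes 4 Y w^2, and the terms in 1 / (q
      w) and in K become \<mu> times 2 Y w and 8 Y w.\<close>
    also have "\<dots> = \<mu> + 4 * real Y * w ^ 2 + \<mu> * (10 * real Y * w)"
      using \<mu>(1) q_pos w(1) unfolding \<mu>(3) by (simp add: field_simps power2_eq_square) (simp add: w(3) power2_eq_square algebra_simps)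
    also have "\<dots> \<le> 1 + 4 * real Y * w + 1 * (10 * real Y * w)"
      using \<mu> w(1,2) by (intro add_mono mult_right_mono mult_left_mono) (auto simp: power2_eq_square mult_left_le)
    finally show "real m / real q * (1 + 2 * real Y ^ 2 * (1 / K) + 4 * real K * real Y / q) \<le> 1 + 14 * real Y * w"
      by (simp add: \<mu>_def mult_ac)
  qed (use Z_ge_1 in auto)
  also have "\<dots> = 16 * Z * (real Y ^ 2 + 14 * real Y ^ 3 * w)"
    by (simp add: algebra_simps power2_eq_square power3_eq_cube)
  finally show ?thesis
    by (simp add: C_def w_def)
qed

text \<open>The term Y^2 is the order of the trivial solutions {x, y} = {x', y'}; the other one is
  Y^(7/2) q^(-1/2). The class c = 0, whose gcd with q is q itself, is set apart and has at most 2 Y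
  pairs by uniqueness of the second coordinate. Sorting the other classes by gcd costs the number of
  divisors of q, hence the second factor \<open>Z\<close>.\<close>

lemma recip_energy_le:
  fixes B :: "int set" and Y :: nat
  assumes B: "B \<subseteq> {- int Y..int Y}" "\<And>x. x \<in> B \<Longrightarrow> coprime x (int q)"
      "inj_on (\<lambda>x. x mod int q) B"
    and Y: "1 \<le> Y" "Y \<le> q"
  shows "(\<Sum>c\<in>{0..<int q}. real (card (recip_pairs B c)) ^ 2)
    \<le> 300 * Z ^ 2 * (real Y ^ 2 + real Y ^ 3 * sqrt (real Y / real q))"
proof -
  define W where "W = real Y ^ 3 * sqrt (real Y / real q)"
  have "W \<ge> 0"
    by (simp add: W_def)
  have finB: "finite B"
    using B(1) by (rule finite_subset) auto
  have fin: "finite (recip_pairs B c)" for c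
    by (rule finite_subset[of _ "B \<times> B"]) (auto simp: recip_pairs_def finB)
  have zero: "real (card (recip_pairs B 0)) \<le> 2 * real Y"
  proof -
    have "inj_on fst (recip_pairs B 0)"
      using recip_pairs_snd_unique[OF _ _ B(2,3)] by (intro inj_onI) (metis prod.collapse)
    then have "card (recip_pairs B 0) \<le> card B"
      by (rule card_inj_on_le) (auto simp: recip_pairs_def finB)
    also have "\<dots> \<le> card ({- int Y..int Y} - {0})"
      using B(1,2) coprime_nonzero by (intro card_mono) auto
    finally show ?thesis by simp
  qed
  define D where "D = {d. d dvd q \<and> d < q}"
  define f where "f = (\<lambda>c. real (card (recip_pairs B c)) ^ 2)"
  have "finite D"
    by (rule finite_subset[of _ "{..q}"]) (auto simp: D_def)
  have "card D \<le> divisor_count q"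
    unfolding divisor_count_def using q_pos by (intro card_mono) (auto simp: D_def)
  moreover have "real (divisor_count q) \<le> Z"
    using self_le_power[of q 4] q2 by (intro divisor_count_le) linarith+
  ultimately have "real (card D) \<le> Z"
    by linarith
  have "(\<lambda>c. nat (gcd c (int q))) ` {1..<int q} \<subseteq> D"
  proof safe
    fix c assume c: "c \<in> {1..<int q}"
    have "gcd c (int q) \<le> c"
      using c by (intro zdvd_imp_le) auto
    then have "gcd c (int q) < int q"
      using c by (meson atLeastLessThan_iff le_less_trans)
    then have "nat (gcd c (int q)) < q"
      using q_pos by (subst nat_less_iff) auto
    moreover have "nat (gcd c (int q)) dvd q"
      by (simp add: nat_dvd_iff)
    ultimately show "nat (gcd c (int q)) \<in> D"
      by (simp add: D_def)
  qed
  have "(\<Sum>c\<in>{1..<int q}. f c) = (\<Sum>d\<in>D. \<Sum>c\<in>{c \<in> {1..<int q}. nat (gcd c (int q)) = d}. f c)"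
    using \<open>finite D\<close> \<open>_ \<subseteq> D\<close> by (intro sum.group[symmetric]) auto
  also have "\<dots> = (\<Sum>d\<in>D. \<Sum>c\<in>{c \<in> {1..<int q}. gcd c (int q) = int d}. f c)"
    by (intro sum.cong refl) auto
  also have "\<dots> \<le> (\<Sum>d\<in>D. 16 * Z * (real Y ^ 2 + 14 * W))"
    unfolding f_def W_def using sum_recip_pairs_gcd_le[OF B Y] by (intro sum_mono) (auto simp: D_def mult.assoc)
  also have "\<dots> = real (card D) * (16 * Z * (real Y ^ 2 + 14 * W))"
    by simp
  also have "\<dots> \<le> Z * (16 * Z * (real Y ^ 2 + 14 * W))"
    using \<open>real (card D) \<le> Z\<close> Z_ge_1 \<open>W \<ge> 0\<close> by (intro mult_right_mono) auto
  finally have nonzero: "(\<Sum>c\<in>{1..<int q}. f c) \<le> Z * (16 * Z * (real Y ^ 2 + 14 * W))" .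
  have "{0..<int q} = insert 0 {1..<int q}"
    using q_pos by auto
  then have "(\<Sum>c\<in>{0..<int q}. f c) = f 0 + (\<Sum>c\<in>{1..<int q}. f c)"
    by simp
  also have "\<dots> \<le> (2 * real Y) ^ 2 + Z * (16 * Z * (real Y ^ 2 + 14 * W))"
    unfolding f_def by (intro add_mono power_mono zero nonzero[unfolded f_def]) auto
  also have "\<dots> \<le> 300 * Z ^ 2 * (real Y ^ 2 + W)"
  proof -
    have "real Y ^ 2 * 1 \<le> real Y ^ 2 * Z ^ 2"
      using Z_ge_1 by (intro mult_left_mono) auto
    moreover have "0 \<le> Z ^ 2 * W" "0 \<le> real Y ^ 2 * Z ^ 2"
      using \<open>W \<ge> 0\<close> by simp_all
    moreover have "(2 * real Y) ^ 2 + Z * (16 * Z * (real Y ^ 2 + 14 * W))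
        = 4 * real Y ^ 2 + 16 * (real Y ^ 2 * Z ^ 2) + 224 * (Z ^ 2 * W)"
      "300 * Z ^ 2 * (real Y ^ 2 + W) = 300 * (real Y ^ 2 * Z ^ 2) + 300 * (Z ^ 2 * W)"
      by (simp_all add: algebra_simps power2_eq_square)
    ultimately show ?thesis
      by linarith
  qed
  finally show ?thesis
    by (simp add: f_def W_def)
qed

end

subsection \<open>Additive characters\<close>

lemma e_mod_add: "e_mod q (x + y) = e_mod q x * e_mod q y"
  by (simp add: e_mod_def exp_add distrib_left add_divide_distrib)

lemma e_mod_eq_exp: "e_mod q x = exp (\<i> * of_real (2 * pi * real_of_int x / real q))"
  by (simp add: e_mod_def mult_ac)

lemma norm_e_mod [simp]: "norm (e_mod q x) = 1"
  unfolding e_mod_eq_exp by (rule norm_exp_i_times)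

lemma cnj_e_mod: "cnj (e_mod q x) = e_mod q (- x)"
  by (simp add: e_mod_def exp_cnj)

lemma e_mod_eq_1_iff:
  assumes "q > 0"
  shows "e_mod q x = 1 \<longleftrightarrow> int q dvd x"
proof
  assume "e_mod q x = 1"
  then obtain n :: int where "2 * pi * real_of_int x / real q = of_int (2 * n) * pi"
    unfolding e_mod_eq_exp exp_eq_1 by auto
  then have "real_of_int x = real_of_int (int q * n)"
    using assms by (simp add: field_simps)
  then have "x = int q * n"
    by (simp only: of_int_eq_iff)
  then show "int q dvd x" by simp
next
  assume "int q dvd x"
  then obtain n where n: "x = int q * n" ..
  have "2 * pi * real_of_int x / real q = of_int (2 * n) * pi"
    using assms by (simp add: n field_simps)
  then show "e_mod q x = 1"
    unfolding e_mod_eq_exp exp_eq_1 by auto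
qed

lemma e_mod_cong:
  assumes "q > 0" "[x = y] (mod int q)"
  shows "e_mod q x = e_mod q y"
proof -
  have "e_mod q (x - y) = 1"
    using assms by (simp add: e_mod_eq_1_iff cong_iff_dvd_diff)
  then show ?thesis
    using e_mod_add[of q "x - y" y] by simp
qed

lemma e_mod_of_nat_mult: "e_mod q (int n * x) = e_mod q x ^ n"
proof (induction n)
  case (Suc n)
  have "int (Suc n) * x = x + int n * x"
    by (simp add: distrib_right)
  then show ?case
    using Suc by (simp only: e_mod_add power_Suc)
qed (simp add: e_mod_def)

lemma sum_e_mod:
  assumes "q > 0"
  shows "(\<Sum>r\<in>{0..<int q}. e_mod q (r * x)) = (if int q dvd x then of_nat q else 0)"
proof -
  have "(\<Sum>r\<in>{0..<int q}. e_mod q (r * x)) = (\<Sum>n<q. e_mod q x ^ n)"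
    by (rule sum.reindex_bij_witness[of _ int nat]) (auto simp: e_mod_of_nat_mult[symmetric])
  also have "\<dots> = (if int q dvd x then of_nat q else 0)"
  proof (cases "int q dvd x")
    case True
    then show ?thesis
      using e_mod_eq_1_iff[OF assms, of x] by simp
  next
    case False
    have "e_mod q x ^ q = 1"
      using e_mod_of_nat_mult[of q q x] e_mod_eq_1_iff[OF assms, of "int q * x"] by simp
    then show ?thesis
      using False e_mod_eq_1_iff[OF assms, of x] by (simp add: geometric_sum)
  qed
  finally show ?thesis .
qed

text \<open>Parseval modulo q after collecting the frequencies \<open>f i\<close> by residue class.
  The index set is arbitrary so that single units and pairs of units are both covered.\<close>

lemma sum_norm_sq_e_mod:
  fixes w :: "'a \<Rightarrow> complex" and f :: "'a \<Rightarrow> int"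
  assumes "q > 0" "finite I"
  shows "(\<Sum>r\<in>{0..<int q}. norm (\<Sum>i\<in>I. w i * e_mod q (r * f i)) ^ 2)
    = real q * (\<Sum>c\<in>{0..<int q}. norm (\<Sum>i\<in>{i \<in> I. f i mod int q = c}. w i) ^ 2)"
proof -
  define a where "a = (\<lambda>c. \<Sum>i\<in>{i \<in> I. f i mod int q = c}. w i)"
  define R where "R = {0..<int q}"
  have group: "(\<Sum>i\<in>I. w i * e_mod q (r * f i)) = (\<Sum>c\<in>R. a c * e_mod q (r * c))" for r
  proof -
    have "(\<Sum>i\<in>I. w i * e_mod q (r * f i))
        = (\<Sum>c\<in>R. \<Sum>i\<in>{i \<in> I. f i mod int q = c}. w i * e_mod q (r * f i))"
      using assms by (intro sum.group[symmetric]) (auto simp: R_def)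
    also have "\<dots> = (\<Sum>c\<in>R. \<Sum>i\<in>{i \<in> I. f i mod int q = c}. w i * e_mod q (r * c))"
    proof (intro sum.cong refl)
      fix c i assume "i \<in> {i \<in> I. f i mod int q = c}"
      then have "[f i = c] (mod int q)"
        by (auto simp: cong_def)
      then have "e_mod q (r * f i) = e_mod q (r * c)"
        using assms by (intro e_mod_cong cong_mult cong_refl)
      then show "w i * e_mod q (r * f i) = w i * e_mod q (r * c)"
        by simp
    qed
    finally show ?thesis
      by (simp add: a_def sum_distrib_right)
  qed
  have "complex_of_real (\<Sum>r\<in>R. norm (\<Sum>i\<in>I. w i * e_mod q (r * f i)) ^ 2)
      = (\<Sum>r\<in>R. \<Sum>c\<in>R. \<Sum>c'\<in>R. a c * cnj (a c') * e_mod q (r * (c - c')))"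
  proof -
    have "complex_of_real (norm (\<Sum>i\<in>I. w i * e_mod q (r * f i)) ^ 2)
        = (\<Sum>c\<in>R. \<Sum>c'\<in>R. a c * cnj (a c') * e_mod q (r * (c - c')))" for r
    proof -
      have "e_mod q (r * (c - c')) = e_mod q (r * c) * cnj (e_mod q (r * c'))" for c c'
        using e_mod_add[of q "r * c" "- (r * c')"] by (simp add: cnj_e_mod right_diff_distrib)
      then show ?thesis
        unfolding group complex_norm_square cnj_sum sum_product
        by (intro sum.cong refl) simp
    qed
    then show ?thesis
      unfolding of_real_sum by (intro sum.cong refl)
  qed
  also have "\<dots> = (\<Sum>c\<in>R. \<Sum>r\<in>R. \<Sum>c'\<in>R. a c * cnj (a c') * e_mod q (r * (c - c')))"
    by (rule sum.swap)
  also have "\<dots> = (\<Sum>c\<in>R. \<Sum>c'\<in>R. \<Sum>r\<in>R. a c * cnj (a c') * e_mod q (r * (c - c')))"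
    by (intro sum.cong refl sum.swap)
  also have "\<dots> = (\<Sum>c\<in>R. \<Sum>c'\<in>R. if c' = c then a c * cnj (a c') * of_nat q else 0)"
  proof (intro sum.cong refl)
    fix c c' assume "c \<in> R" "c' \<in> R"
    then have "int q dvd c - c' \<longleftrightarrow> c' = c"
      using mod_eq_dvd_iff[of c "int q" c'] by (auto simp: R_def)
    then show "(\<Sum>r\<in>R. a c * cnj (a c') * e_mod q (r * (c - c'))) = (if c' = c then a c * cnj (a c') * of_nat q else 0)"
      using sum_e_mod[OF assms(1), of "c - c'"] sum_distrib_left[of "a c * cnj (a c')" "\<lambda>r. e_mod q (r * (c - c'))" R]
      by (auto simp: R_def)
  qed
  also have "\<dots> = complex_of_real (real q * (\<Sum>c\<in>R. norm (a c) ^ 2))"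
  proof -
    have "(\<Sum>c'\<in>R. if c' = c then a c * cnj (a c') * of_nat q else 0) = of_nat q * of_real (norm (a c) ^ 2)"
      if "c \<in> R" for c
      using that unfolding complex_norm_square by (simp add: R_def)
    then show ?thesis
      unfolding of_real_mult of_real_sum sum_distrib_left of_real_of_nat_eq by (intro sum.cong refl)
  qed
  finally show ?thesis
    unfolding of_real_eq_iff by (simp add: R_def a_def)
qed

section \<open>Size of exponential sums over intervals\<close>

lemma half_le_sin:
  fixes t :: real
  assumes "0 \<le> t" "t \<le> pi / 2"
  shows "t / 2 \<le> sin t"
proof -
  have "\<bar>sin t - (\<Sum>m<3. sin_coeff m * t ^ m)\<bar> \<le> inverse (fact 3) * \<bar>t\<bar> ^ 3"
    by (rule Maclaurin_sin_bound)
  moreover have "(\<Sum>m<3. sin_coeff m * t ^ m) = t"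
    by (simp add: sin_coeff_def numeral_3_eq_3)
  moreover have "inverse (fact 3) * \<bar>t\<bar> ^ 3 = t ^ 3 / 6"
  proof -
    have "fact 3 = (6 :: real)"
      by (simp add: fact_numeral)
    then show ?thesis
      using assms by (simp only: abs_of_nonneg inverse_eq_divide times_divide_eq_left mult_1)
  qed
  ultimately have "sin t \<ge> t - t ^ 3 / 6"
    by linarith
  \<comment> \<open>With t^2 \<le> 3 the cubic Taylor term t^3 / 6 takes away at most half of
    t.\<close>
  moreover have "t * t ^ 2 \<le> t * 3"
  proof (rule mult_left_mono)
    have "t \<le> 1.6"
      using assms pi_approx by simp
    then have "t ^ 2 \<le> 1.6 ^ 2"
      using assms by (intro power_mono) auto
    then show "t ^ 2 \<le> 3" by (simp add: power2_eq_square)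
  qed (use assms in auto)
  then have "t ^ 3 \<le> 3 * t"
    by (simp add: power2_eq_square power3_eq_cube)
  ultimately show ?thesis by linarith
qed

definition interval_char_sum :: "nat \<Rightarrow> int \<Rightarrow> nat \<Rightarrow> int \<Rightarrow> complex" where
  "interval_char_sum q v M x = (\<Sum>m\<in>{v + 1..v + int M}. e_mod q (m * x))"

lemma norm_interval_char_sum_le_length: "norm (interval_char_sum q v M x) \<le> real M"
  unfolding interval_char_sum_def by (rule order.trans[OF norm_sum]) simp

lemma interval_char_sum_telescope:
  "(e_mod q x - 1) * interval_char_sum q v M x = e_mod q ((v + int M + 1) * x) - e_mod q ((v + 1) * x)"
proof (induction M)
  case (Suc M)
  have "{v + 1..v + int (Suc M)} = insert (v + int M + 1) {v + 1..v + int M}"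
    by auto
  then have "interval_char_sum q v (Suc M) x = e_mod q ((v + int M + 1) * x) + interval_char_sum q v M x"
    by (simp add: interval_char_sum_def)
  moreover have "(v + int (Suc M) + 1) * x = (v + int M + 1) * x + x"
    by (simp add: algebra_simps)
  ultimately show ?case
    using Suc by (simp only: e_mod_add[of q "(v + int M + 1) * x" x]) (simp add: algebra_simps)
qed (simp add: interval_char_sum_def)

text \<open>A geometric sum: the numerator is at most 2, and the denominator 2 sin t, with t = pi
  |x| / q, is at least t and so at least 2 |x| / q. The restriction to |x| \<le> q/2 puts t into the
  range of \<open>half_le_sin\<close>.\<close>

lemma norm_interval_char_sum_le:
  assumes "q > 0" "x \<noteq> 0" "2 * \<bar>x\<bar> \<le> int q"
  shows "norm (interval_char_sum q v M x) \<le> real q / real_of_int \<bar>x\<bar>"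
proof -
  define t where "t = pi * real_of_int \<bar>x\<bar> / real q"
  have "2 * real_of_int \<bar>x\<bar> \<le> real q"
    using assms(3) by linarith
  then have t: "0 \<le> t" "t \<le> pi / 2"
    using assms by (auto simp: t_def field_simps)
  have "norm (e_mod q x - 1) = 2 * \<bar>sin (pi * real_of_int x / real q)\<bar>"
    unfolding e_mod_eq_exp dist_exp_i_1 by (simp add: mult.assoc)
  also have "\<bar>sin (pi * real_of_int x / real q)\<bar> = \<bar>sin t\<bar>"
    by (cases "x \<ge> 0") (auto simp: t_def)
  also have "2 * \<bar>sin t\<bar> \<ge> t"
    using half_le_sin[OF t] by linarith
  finally have "t * norm (interval_char_sum q v M x) \<le> norm ((e_mod q x - 1) * interval_char_sum q v M x)"
    by (simp add: norm_mult mult_right_mono)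
  also have "\<dots> \<le> 1 + 1"
    unfolding interval_char_sum_telescope by (rule order.trans[OF norm_triangle_ineq4]) simp
  finally have "t * norm (interval_char_sum q v M x) \<le> 2" by simp
  moreover have "2 * (real_of_int \<bar>x\<bar> / real q) \<le> t"
    using pi_ge_two mult_right_mono[of 2 pi "real_of_int \<bar>x\<bar> / real q"] by (simp add: t_def)
  then have "2 * (real_of_int \<bar>x\<bar> / real q) * norm (interval_char_sum q v M x) \<le> t * norm (interval_char_sum q v M x)"
    by (rule mult_right_mono) simp
  ultimately have "real_of_int \<bar>x\<bar> / real q * norm (interval_char_sum q v M x) \<le> 1" by simp
  then show ?thesis
    using assms by (simp add: field_simps)
qed

subsection \<open>Moments of the dyadic pieces\<close>

lemma norm_sum_sq_le:
  fixes f :: "'a \<Rightarrow> 'b::real_normed_vector"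
  assumes "finite I"
  shows "norm (\<Sum>i\<in>I. f i) ^ 2 \<le> real (card I) * (\<Sum>i\<in>I. norm (f i) ^ 2)"
proof -
  have "norm (\<Sum>i\<in>I. f i) ^ 2 \<le> (\<Sum>i\<in>I. norm (f i)) ^ 2"
    by (intro power_mono norm_sum) auto
  also have "\<dots> \<le> (\<Sum>i\<in>I. norm (f i) ^ 2) * real (card I)"
    using Cauchy_Schwarz_ineq_sum[of "\<lambda>i. norm (f i)" "\<lambda>_. 1" I] by simp
  finally show ?thesis by (simp add: mult.commute)
qed

lemma norm_sum_pow4_le:
  fixes f :: "'a \<Rightarrow> 'b::real_normed_vector"
  assumes "finite I"
  shows "norm (\<Sum>i\<in>I. f i) ^ 4 \<le> real (card I) ^ 3 * (\<Sum>i\<in>I. norm (f i) ^ 4)"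
proof -
  have "norm (\<Sum>i\<in>I. f i) ^ 4 = (norm (\<Sum>i\<in>I. f i) ^ 2) ^ 2"
    by (simp flip: power_mult)
  also have "\<dots> \<le> (real (card I) * (\<Sum>i\<in>I. norm (f i) ^ 2)) ^ 2"
    by (intro power_mono norm_sum_sq_le assms) auto
  also have "\<dots> = real (card I) ^ 2 * norm (\<Sum>i\<in>I. norm (f i) ^ 2) ^ 2"
    by (simp add: power_mult_distrib)
  also have "\<dots> \<le> real (card I) ^ 2 * (real (card I) * (\<Sum>i\<in>I. norm (norm (f i) ^ 2) ^ 2))"
    by (intro mult_left_mono norm_sum_sq_le assms) auto
  also have "\<dots> = real (card I) ^ 3 * (\<Sum>i\<in>I. norm (f i) ^ 4)"
    by (simp add: power2_eq_square power3_eq_cube power4_eq_xxxx mult.assoc)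
  finally show ?thesis .
qed

section \<open>Centred units and their dyadic shells\<close>

context loss
begin

text \<open>Residues of least absolute value, because the bound q / |x| for interval sums holds for
  |x| \<le> q/2 only. The strict left end keeps just one of q/2 and -q/2.\<close>

definition centred_units :: "int set" where
  "centred_units = {x. coprime x (int q) \<and> - int q < 2 * x \<and> 2 * x \<le> int q}"

definition shell :: "nat \<Rightarrow> int set" where
  "shell j = {x \<in> centred_units. 2 ^ j \<le> \<bar>x\<bar> \<and> \<bar>x\<bar> < 2 ^ (j + 1)}"

definition num_shells :: nat where
  "num_shells = (LEAST J. q < 2 ^ J)"

lemma centred_unitsD:
  assumes "x \<in> centred_units"
  shows "coprime x (int q)" "x \<noteq> 0" "2 * \<bar>x\<bar> \<le> int q"
  using assms coprime_nonzero[of x] by (auto simp: centred_units_def)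

lemma finite_centred_units: "finite centred_units"
  by (rule finite_subset[of _ "{- int q..int q}"]) (auto simp: centred_units_def)

lemma shell_subset: "shell j \<subseteq> centred_units"
  by (auto simp: shell_def)

lemma finite_shell: "finite (shell j)"
  using shell_subset finite_centred_units by (rule finite_subset)

lemma inj_on_centred_units: "inj_on (\<lambda>x. x mod int q) centred_units"
proof (rule inj_onI)
  fix x y assume xy: "x \<in> centred_units" "y \<in> centred_units" "x mod int q = y mod int q"
  then have "int q dvd x - y"
    by (simp add: mod_eq_dvd_iff)
  moreover have "\<bar>x - y\<bar> < int q"
    using xy by (auto simp: centred_units_def)
  ultimately show "x = y"
    using zdvd_not_zless[of "\<bar>x - y\<bar>" "int q"] by (cases "x = y") auto
qed

text \<open>Performs the substitution of 1/x for x and the passage from least non-negative to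
  centred representatives in one reindexing.\<close>

lemma bij_betw_inv_mod: "bij_betw inv_mod centred_units (units_mod q)"
proof (rule bij_betw_imageI)
  show "inj_on inv_mod centred_units"
  proof (rule inj_onI)
    fix x y assume *: "x \<in> centred_units" "y \<in> centred_units" "inv_mod x = inv_mod y"
    then have "x mod int q = y mod int q"
      using centred_unitsD by (intro inv_mod_cong_iff) auto
    then show "x = y"
      using * inj_on_centred_units by (auto dest: inj_onD)
  qed
  show "inv_mod ` centred_units = units_mod q"
  proof safe
    fix x assume "x \<in> centred_units"
    then show "inv_mod x \<in> units_mod q"
      using centred_unitsD(1) q_pos
      by (auto simp: units_mod_def modular_inverse_int_nonneg modular_inverse_int_less)
  next
    fix y assume "y \<in> units_mod q"
    then have y: "y \<in> {0..<int q}" "coprime y (int q)"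
      by (auto simp: units_mod_def)
    define x where "x = (if 2 * inv_mod y \<le> int q then inv_mod y else inv_mod y - int q)"
    have "[x = inv_mod y] (mod int q)"
      by (auto simp: x_def cong_iff_dvd_diff)
    then have "[y * x = y * inv_mod y] (mod int q)"
      by (rule cong_scalar_left)
    also have "[y * inv_mod y = 1] (mod int q)"
      by (rule inv_mod_cong[OF y(2)])
    finally have xy: "[x * y = 1] (mod int q)"
      by (simp add: mult.commute)
    then have "inv_mod x = y"
      using y by (intro modular_inverse_int_eqI) auto
    moreover have "coprime x (int q)"
      using xy coprime_iff_invertible_int by blast
    then have "x \<in> centred_units"
      using modular_inverse_int_nonneg[of "int q" y] modular_inverse_int_less[of "int q" y] q_pos
      by (auto simp: centred_units_def x_def)
    ultimately show "y \<in> inv_mod ` centred_units" by blast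
  qed
qed

lemma inv_mod_inv_mod_cong:
  assumes "coprime x (int q)"
  shows "[inv_mod (inv_mod x) = x] (mod int q)"
proof -
  have "[inv_mod x * inv_mod (inv_mod x) = 1] (mod int q)"
    using assms by (intro inv_mod_cong coprime_modular_inverse)
  then have "[x * (inv_mod x * inv_mod (inv_mod x)) = x * 1] (mod int q)"
    by (rule cong_scalar_left)
  moreover have "[(x * inv_mod x) * inv_mod (inv_mod x) = 1 * inv_mod (inv_mod x)] (mod int q)"
    by (intro cong_scalar_right inv_mod_cong assms)
  ultimately show ?thesis
    by (simp add: cong_def mult.assoc)
qed

text \<open>The divisor bound also controls the logarithm: if 2^n \<le> q < 2^(n+1), the n + 1
  powers 1, 2, ..., 2^n all divide 2^n.\<close>

lemma num_shells_le: "real num_shells \<le> Z"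
proof -
  have ex: "q < 2 ^ q"
    by (rule less_exp)
  then have "q < 2 ^ num_shells"
    unfolding num_shells_def by (rule LeastI)
  then obtain n where n: "num_shells = Suc n"
    using q_pos by (cases num_shells) auto
  have "2 ^ n \<le> q"
    using not_less_Least[of n "\<lambda>J. q < 2 ^ J"] n by (simp add: num_shells_def not_less)
  have "inj_on (\<lambda>i. 2 ^ i :: nat) {..n}"
    by (auto intro!: inj_onI)
  then have "card {..n} \<le> card {d::nat. d dvd 2 ^ n}"
    by (rule card_inj_on_le) (auto simp: le_imp_power_dvd)
  then have "real num_shells \<le> real (divisor_count (2 ^ n))"
    by (simp add: n divisor_count_def)
  also have "\<dots> \<le> Z"
    using self_le_power[of q 4] q2 \<open>2 ^ n \<le> q\<close> by (intro divisor_count_le) (simp, linarith)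
  finally show ?thesis .
qed

lemma centred_units_eq_shells: "centred_units = (\<Union>j<num_shells. shell j)"
proof (rule equalityI, rule subsetI)
  fix x assume x: "x \<in> centred_units"
  define n where "n = nat \<bar>x\<bar>"
  have "n \<ge> 1"
    using centred_unitsD(2)[OF x] by (simp add: n_def)
  then obtain j where j: "2 ^ j \<le> n" "n < 2 ^ (j + 1)"
    using ex_power_ivl1[of 2 n] by auto
  have "(2::int) ^ j \<le> \<bar>x\<bar>" "\<bar>x\<bar> < 2 ^ (j + 1)"
    using j by (simp_all add: n_def le_nat_iff nat_less_iff)
  then have "x \<in> shell j"
    using x by (simp add: shell_def)
  have "q < 2 ^ num_shells"
    unfolding num_shells_def by (rule LeastI) (rule less_exp)
  moreover have "n \<le> q"
    using centred_unitsD(3)[OF x] by (simp add: n_def)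
  ultimately have "(2::nat) ^ j < 2 ^ num_shells"
    using j by linarith
  then have "j < num_shells"
    by simp
  then show "x \<in> (\<Union>j<num_shells. shell j)"
    using \<open>x \<in> shell j\<close> by blast
qed (use shell_subset in auto)

lemma shell_disjoint:
  assumes "i \<noteq> j"
  shows "shell i \<inter> shell j = {}"
proof -
  have *: "shell i \<inter> shell j = {}" if "i < j" for i j
  proof -
    have "(2::int) ^ (i + 1) \<le> 2 ^ j"
      using that by (intro power_increasing) auto
    then show ?thesis
      by (force simp: shell_def)
  qed
  show ?thesis
    using assms *[of i j] *[of j i] by (cases i j rule: linorder_cases) auto
qed

lemma sum_centred_units: "(\<Sum>x\<in>centred_units. f x) = (\<Sum>j<num_shells. \<Sum>x\<in>shell j. f x)"
  for f :: "int \<Rightarrow> 'a::comm_monoid_add"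
  unfolding centred_units_eq_shells
  by (rule sum.UNION_disjoint) (auto simp: finite_shell shell_disjoint)

lemma shell_bounds: "shell j \<subseteq> {- int (2 ^ (j + 1))..int (2 ^ (j + 1))}"
  by (auto simp: shell_def)

lemma card_shell_le: "real (card (shell j)) \<le> 2 * 2 ^ (j + 1)"
proof -
  have "shell j \<subseteq> {- int (2 ^ (j + 1))..int (2 ^ (j + 1))} - {0}"
    using shell_bounds[of j] centred_unitsD(2) shell_subset[of j] by blast
  then have "card (shell j) \<le> card ({- int (2 ^ (j + 1))..int (2 ^ (j + 1))} - {0})"
    by (intro card_mono) auto
  also have "\<dots> = 2 * 2 ^ (j + 1)"
    by (simp add: card_Diff_singleton nat_add_distrib nat_mult_distrib nat_power_eq)
  finally have "real (card (shell j)) \<le> real (2 * 2 ^ (j + 1))"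
    by (rule of_nat_mono)
  then show ?thesis by simp
qed

text \<open>Supplies Y \<le> q in \<open>recip_energy_le\<close> for the outer radius Y = 2^(j+1);
  the doubling is affordable because |x| \<le> q/2.\<close>

lemma shell_scale_le:
  assumes "shell j \<noteq> {}"
  shows "2 ^ (j + 1) \<le> q"
proof -
  obtain x where "x \<in> centred_units" "2 ^ j \<le> \<bar>x\<bar>"
    using assms by (auto simp: shell_def)
  then have "(2::int) ^ (j + 1) \<le> int q"
    using centred_unitsD(3)[of x] by simp
  then have "int (2 ^ (j + 1)) \<le> int q"
    by simp
  then show ?thesis
    by (simp only: of_nat_le_iff)
qed

text \<open>Uniform bound for interval sums on \<open>shell j\<close>. The value q / 2^j is written
  with the outer radius X = 2^(j+1), since the estimates use it through amp * X \<le> 2 q.\<close>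

definition amp :: "nat \<Rightarrow> nat \<Rightarrow> real" where
  "amp M j = min (real M) (2 * real q / 2 ^ (j + 1))"

lemma amp_bounds: "0 \<le> amp M j" "amp M j \<le> real M" "amp M j * 2 ^ (j + 1) \<le> 2 * real q"
proof -
  have "amp M j * 2 ^ (j + 1) \<le> (2 * real q / 2 ^ (j + 1)) * 2 ^ (j + 1)"
    by (intro mult_right_mono) (auto simp: amp_def)
  then show "amp M j * 2 ^ (j + 1) \<le> 2 * real q"
    by (simp del: power_Suc)
qed (auto simp: amp_def)

lemma norm_interval_char_sum_le_amp:
  assumes "x \<in> shell j"
  shows "norm (interval_char_sum q v M x) \<le> amp M j"
proof -
  have x: "x \<noteq> 0" "2 * \<bar>x\<bar> \<le> int q" "2 ^ j \<le> \<bar>x\<bar>"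
    using assms centred_unitsD by (auto simp: shell_def)
  have "real_of_int (2 ^ j) \<le> real_of_int \<bar>x\<bar>"
    using x(3) by (simp only: of_int_le_iff)
  then have "real q / real_of_int \<bar>x\<bar> \<le> real q / 2 ^ j"
    using x by (intro divide_left_mono) auto
  then have "norm (interval_char_sum q v M x) \<le> real q / 2 ^ j"
    using norm_interval_char_sum_le[OF q_pos x(1,2), of v M] by linarith
  then show ?thesis
    using norm_interval_char_sum_le_length[of q v M x] by (simp add: amp_def)
qed

text \<open>On every shell the number of points times the size of the sum is at most 4 q, whatever M
  is, so only the number of shells is lost.\<close>

lemma sum_norm_interval_char_sum_le:
  "(\<Sum>x\<in>centred_units. norm (interval_char_sum q v M x)) \<le> 4 * Z * real q"
proof -
  have "(\<Sum>x\<in>shell j. norm (interval_char_sum q v M x)) \<le> 4 * real q" for j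
  proof -
    have "(\<Sum>x\<in>shell j. norm (interval_char_sum q v M x)) \<le> real (card (shell j)) * amp M j"
      by (rule sum_bounded_above) (rule norm_interval_char_sum_le_amp)
    also have "\<dots> \<le> (2 * 2 ^ (j + 1)) * amp M j"
      by (intro mult_right_mono card_shell_le amp_bounds)
    also have "\<dots> \<le> 4 * real q"
      using amp_bounds(3)[of M j] by (simp add: mult_ac)
    finally show ?thesis .
  qed
  then have "(\<Sum>x\<in>centred_units. norm (interval_char_sum q v M x)) \<le> (\<Sum>j<num_shells. 4 * real q)"
    unfolding sum_centred_units by (rule sum_mono)
  also have "\<dots> = real num_shells * (4 * real q)"
    by simp
  also have "\<dots> \<le> Z * (4 * real q)"
    by (intro mult_right_mono num_shells_le) auto
  finally show ?thesis by simp
qed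

lemma sum_norm_sq_interval_char_sum_le:
  "(\<Sum>x\<in>centred_units. norm (interval_char_sum q v M x) ^ 2) \<le> 4 * Z * real q * real M"
proof -
  have "(\<Sum>x\<in>centred_units. norm (interval_char_sum q v M x) ^ 2)
      \<le> (\<Sum>x\<in>centred_units. real M * norm (interval_char_sum q v M x))"
    unfolding power2_eq_square by (intro sum_mono mult_right_mono norm_interval_char_sum_le_length) auto
  also have "\<dots> = real M * (\<Sum>x\<in>centred_units. norm (interval_char_sum q v M x))"
    by (simp add: sum_distrib_left)
  also have "\<dots> \<le> real M * (4 * Z * real q)"
    by (intro mult_left_mono sum_norm_interval_char_sum_le) auto
  finally show ?thesis by (simp add: mult_ac)
qed

section \<open>Moments of the sums V and W\<close>

definition V_sum :: "int set \<Rightarrow> int \<Rightarrow> nat \<Rightarrow> int \<Rightarrow> complex" where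
  "V_sum B w N c = (\<Sum>y\<in>B. interval_char_sum q w N y * e_mod q (c * inv_mod y))"

definition W_sum :: "(int \<Rightarrow> complex) \<Rightarrow> int set \<Rightarrow> int set \<Rightarrow> int \<Rightarrow> nat \<Rightarrow> int \<Rightarrow> complex" where
  "W_sum \<alpha> A B v M c = (\<Sum>p\<in>{p \<in> A \<times> B. fst p * inv_mod (snd p) mod int q = c}.
      \<alpha> (fst p) * interval_char_sum q v M (snd p))"

lemma V_sum_shells: "V_sum centred_units w N c = (\<Sum>j<num_shells. V_sum (shell j) w N c)"
  unfolding V_sum_def by (rule sum_centred_units)

lemma W_sum_shells:
  assumes "finite A"
  shows "W_sum \<alpha> A centred_units v M c = (\<Sum>j<num_shells. W_sum \<alpha> A (shell j) v M c)"
proof -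
  have "{p \<in> A \<times> centred_units. fst p * inv_mod (snd p) mod int q = c} =
      (\<Union>j<num_shells. {p \<in> A \<times> shell j. fst p * inv_mod (snd p) mod int q = c})"
    unfolding centred_units_eq_shells by auto
  moreover have "finite {p \<in> A \<times> shell j. fst p * inv_mod (snd p) mod int q = c}" for j
    using finite_cartesian_product[OF assms finite_shell[of j]] by (rule rev_finite_subset) auto
  moreover have "{p \<in> A \<times> shell i. fst p * inv_mod (snd p) mod int q = c} \<inter>
      {p \<in> A \<times> shell j. fst p * inv_mod (snd p) mod int q = c} = {}" if "i \<noteq> j" for i j
    using shell_disjoint[OF that] by blast
  ultimately show ?thesis
    unfolding W_sum_def by (simp only:) (rule sum.UNION_disjoint, auto)
qed

text \<open>Parseval; since y is determined by 1/y, each residue class holds at most one term and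
  only the diagonal remains.\<close>

lemma sum_V_sum_sq_le:
  "(\<Sum>c\<in>{0..<int q}. norm (V_sum centred_units w N c) ^ 2) \<le> 4 * Z * real N * real q ^ 2"
proof -
  have "(\<Sum>c\<in>{0..<int q}. norm (V_sum centred_units w N c) ^ 2)
      = real q * (\<Sum>c\<in>{0..<int q}. norm (\<Sum>y\<in>{y \<in> centred_units. inv_mod y mod int q = c}. interval_char_sum q w N y) ^ 2)"
    unfolding V_sum_def by (rule sum_norm_sq_e_mod[OF q_pos finite_centred_units])
  also have "(\<Sum>c\<in>{0..<int q}. norm (\<Sum>y\<in>{y \<in> centred_units. inv_mod y mod int q = c}. interval_char_sum q w N y) ^ 2)
      = (\<Sum>c\<in>{0..<int q}. \<Sum>y\<in>{y \<in> centred_units. inv_mod y mod int q = c}. norm (interval_char_sum q w N y) ^ 2)"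
  proof (intro sum.cong refl)
    fix c
    have "x = y" if "x \<in> centred_units" "y \<in> centred_units" "inv_mod x mod int q = inv_mod y mod int q" for x y
    proof -
      have "inv_mod x = inv_mod y"
        using that modular_inverse_int_less modular_inverse_int_nonneg q_pos by simp
      then show ?thesis
        using that bij_betw_inv_mod by (auto simp: bij_betw_def dest: inj_onD)
    qed
    then have S: "{y \<in> centred_units. inv_mod y mod int q = c} = {} \<or> (\<exists>y. {y \<in> centred_units. inv_mod y mod int q = c} = {y})"
      by blast
    have "norm (\<Sum>y\<in>S. interval_char_sum q w N y) ^ 2 = (\<Sum>y\<in>S. norm (interval_char_sum q w N y) ^ 2)"
      if "S = {} \<or> (\<exists>y. S = {y})" for S
      using that by auto
    from this[OF S] show "norm (\<Sum>y\<in>{y \<in> centred_units. inv_mod y mod int q = c}. interval_char_sum q w N y) ^ 2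
        = (\<Sum>y\<in>{y \<in> centred_units. inv_mod y mod int q = c}. norm (interval_char_sum q w N y) ^ 2)" .
  qed
  also have "\<dots> = (\<Sum>y\<in>centred_units. norm (interval_char_sum q w N y) ^ 2)"
    using q_pos finite_centred_units by (intro sum.group) auto
  also have "real q * \<dots> \<le> real q * (4 * Z * real q * real N)"
    by (intro mult_left_mono sum_norm_sq_interval_char_sum_le) auto
  finally show ?thesis by (simp add: power2_eq_square mult_ac)
qed

text \<open>The square of V is an exponential sum over pairs with frequencies 1/x + 1/y, so Parseval
  leads to the energy of \<open>recip_pairs\<close>. A single shell is taken so that all weights
  have the common bound \<open>amp\<close>.\<close>

lemma sum_V_sum_shell_pow4_le:
  "(\<Sum>c\<in>{0..<int q}. norm (V_sum (shell j) w N c) ^ 4)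
    \<le> 3600 * Z ^ 2 * (real N ^ 2 * real q ^ 3 + sqrt (real N) * real q ^ 4)"
proof (cases "shell j = {}")
  case True
  then show ?thesis
    using Z_ge_1 by (simp add: V_sum_def)
next
  case False
  define X where "X = (2::nat) ^ (j + 1)"
  have X: "1 \<le> X" "X \<le> q"
    using shell_scale_le[OF False] by (auto simp: X_def)
  define a where "a = amp N j"
  have a: "0 \<le> a" "a \<le> real N" "a * X \<le> 2 * real q"
    using amp_bounds[of N j] by (auto simp: a_def X_def)
  \<comment> \<open>Splitting off sqrt a leaves sqrt (a X / q), where a X / q \<le> 2; the larger
    9/4 has a rational root.\<close>
  have amp_sqrt: "a * sqrt (real X / real q) \<le> sqrt (real N) * (3 / 2)"
  proof -
    have "a * sqrt (real X / real q) = sqrt a * sqrt (a * X / real q)"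
      using a by (simp add: real_sqrt_mult real_sqrt_divide)
    also have "\<dots> \<le> sqrt (real N) * sqrt (9 / 4)"
      using a q_pos by (intro mult_mono real_sqrt_le_mono) (auto simp: field_simps)
    also have "sqrt (9 / 4) = 3 / (2::real)"
      by (rule real_sqrt_unique) (auto simp: power2_eq_square)
    finally show ?thesis .
  qed
  define f where "f = (\<lambda>p. inv_mod (fst p) + inv_mod (snd p))"
  define \<phi> where "\<phi> = (\<lambda>p. interval_char_sum q w N (fst p) * interval_char_sum q w N (snd p))"
  have fin: "finite (shell j \<times> shell j)"
    using finite_shell by simp
  have pairs: "{p \<in> shell j \<times> shell j. f p mod int q = c} = recip_pairs (shell j) c" for c
    by (auto simp: recip_pairs_def f_def)
  have "norm (V_sum (shell j) w N c) ^ 4 = norm (\<Sum>p\<in>shell j \<times> shell j. \<phi> p * e_mod q (c * f p)) ^ 2" for c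
  proof -
    have "V_sum (shell j) w N c ^ 2 = (\<Sum>p\<in>shell j \<times> shell j. \<phi> p * e_mod q (c * f p))"
      unfolding V_sum_def power2_eq_square sum_product sum.cartesian_product
      by (intro sum.cong) (auto simp: \<phi>_def f_def distrib_left e_mod_add)
    then have sq: "norm (V_sum (shell j) w N c) ^ 2 = norm (\<Sum>p\<in>shell j \<times> shell j. \<phi> p * e_mod q (c * f p))"
      by (metis norm_power)
    then show ?thesis
      unfolding sq[symmetric] by (simp add: power2_eq_square power4_eq_xxxx)
  qed
  then have "(\<Sum>c\<in>{0..<int q}. norm (V_sum (shell j) w N c) ^ 4)
      = real q * (\<Sum>c\<in>{0..<int q}. norm (\<Sum>p\<in>recip_pairs (shell j) c. \<phi> p) ^ 2)"
    using sum_norm_sq_e_mod[OF q_pos fin, of \<phi> f] by (simp add: pairs)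
  also have "\<dots> \<le> real q * (\<Sum>c\<in>{0..<int q}. a ^ 4 * real (card (recip_pairs (shell j) c)) ^ 2)"
  proof (intro mult_left_mono sum_mono)
    fix c
    have "norm (\<Sum>p\<in>recip_pairs (shell j) c. \<phi> p) \<le> (\<Sum>p\<in>recip_pairs (shell j) c. norm (\<phi> p))"
      by (rule norm_sum)
    also have "\<dots> \<le> real (card (recip_pairs (shell j) c)) * (a * a)"
    proof (rule sum_bounded_above)
      fix p assume "p \<in> recip_pairs (shell j) c"
      then have "fst p \<in> shell j" "snd p \<in> shell j"
        by (auto simp: recip_pairs_def)
      then show "norm (\<phi> p) \<le> a * a"
        unfolding \<phi>_def norm_mult a_def
        by (intro mult_mono norm_interval_char_sum_le_amp amp_bounds) auto
    qed
    finally have "norm (\<Sum>p\<in>recip_pairs (shell j) c. \<phi> p) ^ 2 \<le> (real (card (recip_pairs (shell j) c)) * (a * a)) ^ 2"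
      by (rule power_mono) simp
    then show "norm (\<Sum>p\<in>recip_pairs (shell j) c. \<phi> p) ^ 2 \<le> a ^ 4 * real (card (recip_pairs (shell j) c)) ^ 2"
      by (simp add: power2_eq_square power4_eq_xxxx mult_ac)
  qed auto
  also have "\<dots> = real q * a ^ 4 * (\<Sum>c\<in>{0..<int q}. real (card (recip_pairs (shell j) c)) ^ 2)"
    by (simp add: sum_distrib_left mult.assoc)
  also have "\<dots> \<le> real q * a ^ 4 * (300 * Z ^ 2 * (real X ^ 2 + real X ^ 3 * sqrt (real X / real q)))"
  proof (intro mult_left_mono recip_energy_le)
    show "shell j \<subseteq> {- int X..int X}"
      using shell_bounds[of j] by (simp add: X_def)
    show "inj_on (\<lambda>x. x mod int q) (shell j)"
      using inj_on_centred_units shell_subset by (rule inj_on_subset)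
  qed (use X a shell_subset centred_unitsD in auto)
  \<comment> \<open>The four factors a are distributed so that each power of X is matched by one of
    a, leaving a^2 in the first term and a sqrt (X / q) in the second.\<close>
  also have "\<dots> = 300 * Z ^ 2 * (real q * (a ^ 2 * (a * X) ^ 2 + (a * X) ^ 3 * (a * sqrt (real X / real q))))"
    by (simp add: power2_eq_square power3_eq_cube power4_eq_xxxx algebra_simps)
  also have "\<dots> \<le> 300 * Z ^ 2 * (real q * (real N ^ 2 * (2 * real q) ^ 2 + (2 * real q) ^ 3 * (sqrt (real N) * (3 / 2))))"
    using a Z_ge_1 by (intro mult_left_mono add_mono mult_mono[OF power_mono amp_sqrt] mult_mono[OF power_mono power_mono]) auto
  also have "\<dots> \<le> 3600 * Z ^ 2 * (real N ^ 2 * real q ^ 3 + sqrt (real N) * real q ^ 4)"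
  proof -
    have "300 * Z ^ 2 * (real q * (real N ^ 2 * (2 * real q) ^ 2 + (2 * real q) ^ 3 * (sqrt (real N) * (3 / 2))))
        = 1200 * (Z ^ 2 * (real N ^ 2 * real q ^ 3)) + 3600 * (Z ^ 2 * (sqrt (real N) * real q ^ 4))"
      by (simp add: power2_eq_square power3_eq_cube power4_eq_xxxx algebra_simps)
    also have "\<dots> \<le> 3600 * (Z ^ 2 * (real N ^ 2 * real q ^ 3)) + 3600 * (Z ^ 2 * (sqrt (real N) * real q ^ 4))"
      by simp
    also have "\<dots> = 3600 * Z ^ 2 * (real N ^ 2 * real q ^ 3 + sqrt (real N) * real q ^ 4)"
      by (simp add: algebra_simps)
    finally show ?thesis .
  qed
  finally show ?thesis .
qed

text \<open>The power mean inequality over the shells costs the cube of their number and the sum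
  over shells one factor more; this Z^4 joins the Z^2 of each shell.\<close>

lemma sum_V_sum_pow4_le:
  "(\<Sum>c\<in>{0..<int q}. norm (V_sum centred_units w N c) ^ 4)
    \<le> 3600 * Z ^ 6 * (real N ^ 2 * real q ^ 3 + sqrt (real N) * real q ^ 4)"
proof -
  define E where "E = real N ^ 2 * real q ^ 3 + sqrt (real N) * real q ^ 4"
  have "E \<ge> 0"
    by (simp add: E_def)
  have "(\<Sum>c\<in>{0..<int q}. norm (V_sum centred_units w N c) ^ 4)
      \<le> (\<Sum>c\<in>{0..<int q}. real num_shells ^ 3 * (\<Sum>j<num_shells. norm (V_sum (shell j) w N c) ^ 4))"
    unfolding V_sum_shells using norm_sum_pow4_le[of "{..<num_shells}"] by (intro sum_mono) simp
  also have "\<dots> = real num_shells ^ 3 * (\<Sum>j<num_shells. \<Sum>c\<in>{0..<int q}. norm (V_sum (shell j) w N c) ^ 4)"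
    unfolding sum_distrib_left by (rule sum.swap)
  also have "\<dots> \<le> real num_shells ^ 3 * (\<Sum>j<num_shells. 3600 * Z ^ 2 * E)"
    unfolding E_def by (intro mult_left_mono sum_mono sum_V_sum_shell_pow4_le) auto
  also have "\<dots> = real num_shells ^ 4 * (3600 * Z ^ 2 * E)"
    by (simp add: power4_eq_xxxx power3_eq_cube)
  also have "\<dots> \<le> Z ^ 4 * (3600 * Z ^ 2 * E)"
    using \<open>E \<ge> 0\<close> by (intro mult_right_mono power_mono num_shells_le) auto
  also have "\<dots> = 3600 * Z ^ 6 * E"
    by (simp add: mult_ac flip: power_add)
  finally show ?thesis by (simp add: E_def)
qed

text \<open>Bounding each weight by a = \<open>amp M j\<close> leaves the fibre sizes of l/x, that
  is the ratio energy L X + L^2 X^2 / q. Times a^2, with a \<le> M and a X \<le> 2 q, its terms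
  become 2 q L M and 4 q L^2.\<close>

lemma sum_W_sum_shell_sq_le:
  fixes A :: "int set" and u :: int and L M :: nat
  assumes A: "A \<subseteq> {u + 1..u + int L}" "\<And>l. l \<in> A \<Longrightarrow> coprime l (int q)"
    and L: "L \<ge> 1" and \<alpha>: "\<And>l. l \<in> A \<Longrightarrow> norm (\<alpha> l) \<le> 1"
  shows "(\<Sum>c\<in>{0..<int q}. norm (W_sum \<alpha> A (shell j) v M c) ^ 2)
    \<le> 4800 * Z ^ 2 * real q * (real L ^ 2 + real L * real M)"
proof -
  define X where "X = (2::nat) ^ (j + 1)"
  define a where "a = amp M j"
  have a: "0 \<le> a" "a \<le> real M" "a * X \<le> 2 * real q"
    using amp_bounds[of M j] by (auto simp: a_def X_def)
  define F where "F = (\<lambda>c. {(l, x) \<in> A \<times> shell j. l * inv_mod x mod int q = c})"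
  have F: "{p \<in> A \<times> shell j. fst p * inv_mod (snd p) mod int q = c} = F c" for c
    by (auto simp: F_def)
  have "norm (W_sum \<alpha> A (shell j) v M c) ^ 2 \<le> a ^ 2 * real (card (F c)) ^ 2" for c
  proof -
    have "norm (W_sum \<alpha> A (shell j) v M c) \<le> (\<Sum>p\<in>F c. norm (\<alpha> (fst p) * interval_char_sum q v M (snd p)))"
      unfolding W_sum_def F by (rule norm_sum)
    also have "\<dots> \<le> real (card (F c)) * (1 * a)"
    proof (rule sum_bounded_above)
      fix p assume "p \<in> F c"
      then have "fst p \<in> A" "snd p \<in> shell j"
        by (auto simp: F_def)
      then show "norm (\<alpha> (fst p) * interval_char_sum q v M (snd p)) \<le> 1 * a"
        unfolding norm_mult a_def by (intro mult_mono norm_interval_char_sum_le_amp \<alpha>) auto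
    qed
    finally have "norm (W_sum \<alpha> A (shell j) v M c) ^ 2 \<le> (real (card (F c)) * (1 * a)) ^ 2"
      by (rule power_mono) simp
    then show ?thesis
      by (simp add: power_mult_distrib mult.commute)
  qed
  then have "(\<Sum>c\<in>{0..<int q}. norm (W_sum \<alpha> A (shell j) v M c) ^ 2)
      \<le> (\<Sum>c\<in>{0..<int q}. a ^ 2 * real (card (F c)) ^ 2)"
    by (rule sum_mono)
  also have "\<dots> = a ^ 2 * (\<Sum>c\<in>{0..<int q}. real (card (F c)) ^ 2)"
    by (simp add: sum_distrib_left)
  also have "\<dots> \<le> a ^ 2 * (1200 * Z ^ 2 * (real L * real X + real L ^ 2 * real X ^ 2 / real q))"
    unfolding F_def
  proof (intro mult_left_mono ratio_energy_le[OF A _ _ L])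
    show "shell j \<subseteq> {- int X..int X}"
      using shell_bounds[of j] by (simp add: X_def)
  qed (use shell_subset centred_unitsD in auto)
  also have "\<dots> = 1200 * Z ^ 2 * (real L * (a * (a * X)) + real L ^ 2 * ((a * X) * (a * X)) / real q)"
    by (simp add: power2_eq_square algebra_simps)
  also have "\<dots> \<le> 1200 * Z ^ 2 * (real L * (real M * (2 * real q)) + real L ^ 2 * ((2 * real q) * (2 * real q)) / real q)"
    using a by (intro mult_left_mono add_mono divide_right_mono mult_mono[OF a(2,3)] mult_mono[OF a(3,3)]) auto
  also have "\<dots> = 2400 * (Z ^ 2 * real q * (real L * real M)) + 4800 * (Z ^ 2 * real q * real L ^ 2)"
    using q_pos by (simp add: algebra_simps power2_eq_square)
  also have "\<dots> \<le> 4800 * (Z ^ 2 * real q * (real L * real M)) + 4800 * (Z ^ 2 * real q * real L ^ 2)"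
    by simp
  also have "\<dots> = 4800 * Z ^ 2 * real q * (real L ^ 2 + real L * real M)"
    by (simp add: algebra_simps)
  finally show ?thesis .
qed

lemma sum_W_sum_sq_le:
  fixes A :: "int set" and u :: int and L M :: nat
  assumes A: "A \<subseteq> {u + 1..u + int L}" "\<And>l. l \<in> A \<Longrightarrow> coprime l (int q)"
    and L: "L \<ge> 1" and \<alpha>: "\<And>l. l \<in> A \<Longrightarrow> norm (\<alpha> l) \<le> 1"
  shows "(\<Sum>c\<in>{0..<int q}. norm (W_sum \<alpha> A centred_units v M c) ^ 2)
    \<le> 4800 * Z ^ 4 * real q * (real L ^ 2 + real L * real M)"
proof -
  define E where "E = real q * (real L ^ 2 + real L * real M)"
  have "E \<ge> 0"
    by (simp add: E_def)
  have "finite A"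
    using A(1) by (rule finite_subset) auto
  then have "(\<Sum>c\<in>{0..<int q}. norm (W_sum \<alpha> A centred_units v M c) ^ 2)
      \<le> (\<Sum>c\<in>{0..<int q}. real num_shells * (\<Sum>j<num_shells. norm (W_sum \<alpha> A (shell j) v M c) ^ 2))"
    unfolding W_sum_shells[OF \<open>finite A\<close>] using norm_sum_sq_le[of "{..<num_shells}"] by (intro sum_mono) simp
  also have "\<dots> = real num_shells * (\<Sum>j<num_shells. \<Sum>c\<in>{0..<int q}. norm (W_sum \<alpha> A (shell j) v M c) ^ 2)"
    unfolding sum_distrib_left by (rule sum.swap)
  also have "\<dots> \<le> real num_shells * (\<Sum>j<num_shells. 4800 * Z ^ 2 * E)"
    unfolding E_def mult.assoc[symmetric] by (intro mult_left_mono sum_mono sum_W_sum_shell_sq_le[OF A L \<alpha>]) auto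
  also have "\<dots> = real num_shells ^ 2 * (4800 * Z ^ 2 * E)"
    by (simp add: power2_eq_square)
  also have "\<dots> \<le> Z ^ 2 * (4800 * Z ^ 2 * E)"
    using \<open>E \<ge> 0\<close> by (intro mult_right_mono power_mono num_shells_le) auto
  also have "\<dots> = 4800 * Z ^ 4 * E"
    by (simp add: mult_ac flip: power_add)
  finally show ?thesis by (simp add: E_def mult.assoc)
qed

lemma sum_norm_W_sum_le:
  fixes A :: "int set" and u :: int and L M :: nat
  assumes A: "A \<subseteq> {u + 1..u + int L}" and \<alpha>: "\<And>l. l \<in> A \<Longrightarrow> norm (\<alpha> l) \<le> 1"
  shows "(\<Sum>c\<in>{0..<int q}. norm (W_sum \<alpha> A centred_units v M c)) \<le> 4 * Z * real L * real q"
proof -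
  have "finite A"
    using A by (rule finite_subset) auto
  define t where "t = (\<lambda>p. norm (\<alpha> (fst p) * interval_char_sum q v M (snd p)))"
  have "(\<Sum>c\<in>{0..<int q}. norm (W_sum \<alpha> A centred_units v M c))
      \<le> (\<Sum>c\<in>{0..<int q}. \<Sum>p\<in>{p \<in> A \<times> centred_units. fst p * inv_mod (snd p) mod int q = c}. t p)"
    unfolding W_sum_def t_def by (intro sum_mono norm_sum)
  also have "\<dots> = (\<Sum>p\<in>A \<times> centred_units. t p)"
    using \<open>finite A\<close> finite_centred_units q_pos by (intro sum.group) auto
  also have "\<dots> = (\<Sum>l\<in>A. \<Sum>x\<in>centred_units. norm (\<alpha> l) * norm (interval_char_sum q v M x))"
    by (simp add: t_def sum.cartesian_product norm_mult case_prod_unfold)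
  also have "\<dots> \<le> (\<Sum>l\<in>A. \<Sum>x\<in>centred_units. 1 * norm (interval_char_sum q v M x))"
    by (intro sum_mono mult_right_mono \<alpha>) auto
  also have "\<dots> = real (card A) * (\<Sum>x\<in>centred_units. norm (interval_char_sum q v M x))"
    by simp
  also have "\<dots> \<le> real L * (4 * Z * real q)"
    using card_mono[OF _ A] by (intro mult_mono sum_norm_interval_char_sum_le sum_nonneg) auto
  finally show ?thesis by (simp add: mult_ac)
qed

section \<open>The Kloosterman sums as a bilinear form in W and V\<close>

lemma kloosterman2_eq:
  "kloosterman2 q l m n = (\<Sum>x\<in>centred_units. \<Sum>y\<in>centred_units.
     e_mod q (l * inv_mod x * inv_mod y) * e_mod q (m * x) * e_mod q (n * y))"
proof -
  have "kloosterman2 q l m n = (\<Sum>x\<in>centred_units. \<Sum>y\<in>centred_units.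
     e_mod q (l * inv_mod x * inv_mod y + m * inv_mod (inv_mod x) + n * inv_mod (inv_mod y)))"
    unfolding kloosterman2_def
      sum.reindex_bij_betw[OF bij_betw_inv_mod, symmetric, where ?'a = complex] ..
  also have "\<dots> = (\<Sum>x\<in>centred_units. \<Sum>y\<in>centred_units. e_mod q (l * inv_mod x * inv_mod y + m * x + n * y))"
    using centred_unitsD
    by (intro sum.cong refl e_mod_cong q_pos cong_add cong_scalar_left inv_mod_inv_mod_cong cong_refl) auto
  finally show ?thesis
    by (simp add: e_mod_add)
qed

lemma sum_kloosterman2_eq:
  "(\<Sum>m\<in>{v + 1..v + int M}. \<Sum>n\<in>{w + 1..w + int N}. kloosterman2 q l m n)
   = (\<Sum>x\<in>centred_units. interval_char_sum q v M x * V_sum centred_units w N (l * inv_mod x))"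
proof -
  define R where "R = {v + 1..v + int M}"
  define S where "S = {w + 1..w + int N}"
  define b where "b = (\<lambda>x y. e_mod q (l * inv_mod x * inv_mod y))"
  have K: "kloosterman2 q l m n = (\<Sum>(x, y)\<in>centred_units \<times> centred_units. b x y * e_mod q (m * x) * e_mod q (n * y))" for m n
    unfolding kloosterman2_eq b_def by (rule sum.cartesian_product)
  have "(\<Sum>m\<in>R. \<Sum>n\<in>S. kloosterman2 q l m n)
      = (\<Sum>(m, n)\<in>R \<times> S. \<Sum>(x, y)\<in>centred_units \<times> centred_units. b x y * e_mod q (m * x) * e_mod q (n * y))"
    unfolding K by (rule sum.cartesian_product)
  also have "\<dots> = (\<Sum>(x, y)\<in>centred_units \<times> centred_units. \<Sum>(m, n)\<in>R \<times> S. b x y * e_mod q (m * x) * e_mod q (n * y))"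
    unfolding case_prod_unfold by (rule sum.swap)
  also have "\<dots> = (\<Sum>(x, y)\<in>centred_units \<times> centred_units.
      interval_char_sum q v M x * (interval_char_sum q w N y * b x y))"
  proof (intro sum.cong refl, clarify)
    fix x y
    have "(\<Sum>(m, n)\<in>R \<times> S. b x y * e_mod q (m * x) * e_mod q (n * y))
        = (\<Sum>m\<in>R. e_mod q (m * x) * (\<Sum>n\<in>S. e_mod q (n * y) * b x y))"
      by (simp add: sum.cartesian_product[symmetric] sum_distrib_left mult_ac)
    then show "(\<Sum>(m, n)\<in>R \<times> S. b x y * e_mod q (m * x) * e_mod q (n * y))
        = interval_char_sum q v M x * (interval_char_sum q w N y * b x y)"
      by (simp add: interval_char_sum_def R_def S_def sum_distrib_right)
  qed
  also have "\<dots> = (\<Sum>x\<in>centred_units. interval_char_sum q v M x * V_sum centred_units w N (l * inv_mod x))"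
    by (simp add: sum.cartesian_product[symmetric] V_sum_def b_def sum_distrib_left)
  finally show ?thesis
    by (simp add: R_def S_def)
qed

text \<open>V has period q, so the terms can be collected by the class c of l/x. Dropping the l not
  coprime to q, where \<alpha> vanishes, leaves a set \<open>A\<close> to which
  \<open>ratio_energy_le\<close> applies.\<close>

lemma kloosterman2_sum_eq:
  assumes "\<And>l. l \<in> {u + 1..u + int L} \<Longrightarrow> gcd l (int q) > 1 \<Longrightarrow> \<alpha> l = 0"
  defines "A \<equiv> {l \<in> {u + 1..u + int L}. coprime l (int q)}"
  shows "kloosterman2_sum q \<alpha> {u + 1..u + int L} {v + 1..v + int M} {w + 1..w + int N}
    = (\<Sum>c\<in>{0..<int q}. W_sum \<alpha> A centred_units v M c * V_sum centred_units w N c)"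
proof -
  define t where "t = (\<lambda>p. \<alpha> (fst p) * interval_char_sum q v M (snd p))"
  define f where "f = (\<lambda>p. fst p * inv_mod (snd p))"
  have "finite A"
    by (rule finite_subset[of _ "{u + 1..u + int L}"]) (auto simp: A_def)
  have V_mod: "V_sum centred_units w N c = V_sum centred_units w N (c mod int q)" for c
    unfolding V_sum_def
    by (intro sum.cong refl arg_cong2[where f = "(*)"] e_mod_cong q_pos cong_scalar_right) (simp add: cong_def)
  have "kloosterman2_sum q \<alpha> {u + 1..u + int L} {v + 1..v + int M} {w + 1..w + int N}
      = (\<Sum>l\<in>{u + 1..u + int L}. \<alpha> l * (\<Sum>x\<in>centred_units. interval_char_sum q v M x * V_sum centred_units w N (l * inv_mod x)))"
    by (simp add: kloosterman2_sum_def sum_kloosterman2_eq)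
  also have "\<dots> = (\<Sum>l\<in>A. \<alpha> l * (\<Sum>x\<in>centred_units. interval_char_sum q v M x * V_sum centred_units w N (l * inv_mod x)))"
  proof (rule sum.mono_neutral_right)
    show "\<forall>l\<in>{u + 1..u + int L} - A. \<alpha> l * (\<Sum>x\<in>centred_units. interval_char_sum q v M x * V_sum centred_units w N (l * inv_mod x)) = 0"
    proof
      fix l assume l: "l \<in> {u + 1..u + int L} - A"
      then have "gcd l (int q) \<noteq> 1"
        by (auto simp: A_def coprime_iff_gcd_eq_1)
      moreover have "gcd l (int q) > 0"
        using q_pos by simp
      ultimately have "gcd l (int q) > 1"
        by linarith
      then show "\<alpha> l * (\<Sum>x\<in>centred_units. interval_char_sum q v M x * V_sum centred_units w N (l * inv_mod x)) = 0"
        using l assms(1)[of l] by simp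
    qed
  qed (auto simp: A_def)
  also have "\<dots> = (\<Sum>p\<in>A \<times> centred_units. t p * V_sum centred_units w N (f p mod int q))"
    by (simp add: sum_distrib_left sum.cartesian_product case_prod_unfold t_def f_def V_mod[symmetric] mult.assoc)
  also have "\<dots> = (\<Sum>c\<in>{0..<int q}. \<Sum>p\<in>{p \<in> A \<times> centred_units. f p mod int q = c}. t p * V_sum centred_units w N (f p mod int q))"
    using \<open>finite A\<close> finite_centred_units q_pos by (intro sum.group[symmetric]) auto
  also have "\<dots> = (\<Sum>c\<in>{0..<int q}. \<Sum>p\<in>{p \<in> A \<times> centred_units. f p mod int q = c}. t p * V_sum centred_units w N c)"
    by (intro sum.cong refl) auto
  finally show ?thesis
    by (simp add: W_sum_def t_def f_def sum_distrib_right)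
qed

lemma norm_kloosterman2_sum_le:
  fixes u v w :: int and L M N :: nat and \<alpha> :: "int \<Rightarrow> complex"
  assumes L: "L \<ge> 1"
    and \<alpha>: "\<And>l. l \<in> {u + 1..u + int L} \<Longrightarrow> norm (\<alpha> l) \<le> 1"
    and \<alpha>0: "\<And>l. l \<in> {u + 1..u + int L} \<Longrightarrow> gcd l (int q) > 1 \<Longrightarrow> \<alpha> l = 0"
  defines "S \<equiv> norm (kloosterman2_sum q \<alpha> {u + 1..u + int L} {v + 1..v + int M} {w + 1..w + int N})"
  shows "S ^ 2 \<le> 19200 * Z ^ 5 * (real q ^ 3 * real N * (real L ^ 2 + real L * real M))"
    and "S ^ 4 \<le> 16 * 4800 * 3600 * Z ^ 12 * (real L ^ 4 + real L ^ 3 * real M) *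
           (real N ^ 2 * real q ^ 6 + sqrt (real N) * real q ^ 7)"
proof -
  define A where "A = {l \<in> {u + 1..u + int L}. coprime l (int q)}"
  have A: "A \<subseteq> {u + 1..u + int L}" "\<And>l. l \<in> A \<Longrightarrow> coprime l (int q)"
    by (auto simp: A_def)
  have \<alpha>A: "norm (\<alpha> l) \<le> 1" if "l \<in> A" for l
    using \<alpha> A that by blast
  define W where "W = (\<lambda>c. norm (W_sum \<alpha> A centred_units v M c))"
  define V where "V = (\<lambda>c. norm (V_sum centred_units w N c))"
  define R where "R = {0..<int q}"
  have W1: "(\<Sum>c\<in>R. W c) \<le> 4 * Z * real L * real q"
    unfolding R_def W_def by (rule sum_norm_W_sum_le[OF A(1) \<alpha>A])
  have W2: "(\<Sum>c\<in>R. W c ^ 2) \<le> 4800 * Z ^ 4 * real q * (real L ^ 2 + real L * real M)"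
    unfolding R_def W_def by (rule sum_W_sum_sq_le[OF A L \<alpha>A])
  have V2: "(\<Sum>c\<in>R. V c ^ 2) \<le> 4 * Z * real N * real q ^ 2"
    unfolding R_def V_def by (rule sum_V_sum_sq_le)
  have V4: "(\<Sum>c\<in>R. V c ^ 4) \<le> 3600 * Z ^ 6 * (real N ^ 2 * real q ^ 3 + sqrt (real N) * real q ^ 4)"
    unfolding R_def V_def by (rule sum_V_sum_pow4_le)
  have nonneg: "W c \<ge> 0" "V c \<ge> 0" for c
    by (auto simp: W_def V_def)
  have eq: "kloosterman2_sum q \<alpha> {u + 1..u + int L} {v + 1..v + int M} {w + 1..w + int N}
      = (\<Sum>c\<in>R. W_sum \<alpha> A centred_units v M c * V_sum centred_units w N c)"
    unfolding R_def A_def using \<alpha>0 by (rule kloosterman2_sum_eq)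
  have "S \<le> (\<Sum>c\<in>R. W c * V c)"
    unfolding S_def eq W_def V_def norm_mult[symmetric] by (rule norm_sum)
  moreover have "S \<ge> 0"
    by (simp add: S_def)
  ultimately have S2: "S ^ 2 \<le> (\<Sum>c\<in>R. W c * V c) ^ 2"
    by (intro power_mono)
  also have "\<dots> \<le> (\<Sum>c\<in>R. W c ^ 2) * (\<Sum>c\<in>R. V c ^ 2)"
    by (rule Cauchy_Schwarz_ineq_sum)
  also have "\<dots> \<le> (4800 * Z ^ 4 * real q * (real L ^ 2 + real L * real M)) * (4 * Z * real N * real q ^ 2)"
    using Z_ge_1 by (intro mult_mono W2 V2 sum_nonneg) auto
  also have "\<dots> = 19200 * Z ^ 5 * (real q ^ 3 * real N * (real L ^ 2 + real L * real M))"
    by (simp add: power2_eq_square power3_eq_cube eval_nat_numeral mult_ac)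
  finally show "S ^ 2 \<le> 19200 * Z ^ 5 * (real q ^ 3 * real N * (real L ^ 2 + real L * real M))" .
  \<comment> \<open>The Hoelder inequality in two applications of Cauchy-Schwarz: first to sqrt W
    and sqrt W * V, then to W and V^2.\<close>
  have "(\<Sum>c\<in>R. W c * V c) ^ 2 = (\<Sum>c\<in>R. sqrt (W c) * (sqrt (W c) * V c)) ^ 2"
    using nonneg by (simp flip: mult.assoc)
  also have "\<dots> \<le> (\<Sum>c\<in>R. sqrt (W c) ^ 2) * (\<Sum>c\<in>R. (sqrt (W c) * V c) ^ 2)"
    by (rule Cauchy_Schwarz_ineq_sum)
  also have "\<dots> = (\<Sum>c\<in>R. W c) * (\<Sum>c\<in>R. W c * V c ^ 2)"
    using nonneg by (simp add: power_mult_distrib)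
  finally have "S ^ 2 \<le> (\<Sum>c\<in>R. W c) * (\<Sum>c\<in>R. W c * V c ^ 2)"
    using S2 by linarith
  then have "(S ^ 2) ^ 2 \<le> ((\<Sum>c\<in>R. W c) * (\<Sum>c\<in>R. W c * V c ^ 2)) ^ 2"
    by (intro power_mono) auto
  also have "\<dots> = (\<Sum>c\<in>R. W c) ^ 2 * (\<Sum>c\<in>R. W c * V c ^ 2) ^ 2"
    by (rule power_mult_distrib)
  also have "\<dots> \<le> (4 * Z * real L * real q) ^ 2 *
      ((4800 * Z ^ 4 * real q * (real L ^ 2 + real L * real M)) *
       (3600 * Z ^ 6 * (real N ^ 2 * real q ^ 3 + sqrt (real N) * real q ^ 4)))"
  proof (rule mult_mono)
    show "(\<Sum>c\<in>R. W c) ^ 2 \<le> (4 * Z * real L * real q) ^ 2"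
      using nonneg by (intro power_mono W1 sum_nonneg) auto
    have "(\<Sum>c\<in>R. W c * V c ^ 2) ^ 2 \<le> (\<Sum>c\<in>R. W c ^ 2) * (\<Sum>c\<in>R. (V c ^ 2) ^ 2)"
      by (rule Cauchy_Schwarz_ineq_sum)
    also have "\<dots> = (\<Sum>c\<in>R. W c ^ 2) * (\<Sum>c\<in>R. V c ^ 4)"
      by (simp add: power2_eq_square power4_eq_xxxx mult.assoc)
    also have "\<dots> \<le> (4800 * Z ^ 4 * real q * (real L ^ 2 + real L * real M)) *
       (3600 * Z ^ 6 * (real N ^ 2 * real q ^ 3 + sqrt (real N) * real q ^ 4))"
      using Z_ge_1 nonneg by (intro mult_mono W2 V4 sum_nonneg) auto
    finally show "(\<Sum>c\<in>R. W c * V c ^ 2) ^ 2 \<le> (4800 * Z ^ 4 * real q * (real L ^ 2 + real L * real M)) *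
       (3600 * Z ^ 6 * (real N ^ 2 * real q ^ 3 + sqrt (real N) * real q ^ 4))" .
  qed auto
  \<comment> \<open>The first moment squared, the second moment of W and the fourth moment of V
    carry Z^2, Z^4 and Z^6.\<close>
  also have "\<dots> = 16 * 4800 * 3600 * Z ^ 12 * (real L ^ 4 + real L ^ 3 * real M) *
           (real N ^ 2 * real q ^ 6 + sqrt (real N) * real q ^ 7)"
    by (simp add: eval_nat_numeral algebra_simps)
  finally show "S ^ 4 \<le> 16 * 4800 * 3600 * Z ^ 12 * (real L ^ 4 + real L ^ 3 * real M) *
           (real N ^ 2 * real q ^ 6 + sqrt (real N) * real q ^ 7)"
    by (simp add: power2_eq_square power4_eq_xxxx mult.assoc)
qed

end

section \<open>From bounds for powers to the stated minimum\<close>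

lemma add_pow4_ge:
  fixes a b :: real
  assumes "a \<ge> 0" "b \<ge> 0"
  shows "a ^ 4 + b ^ 4 \<le> (a + b) ^ 4"
proof -
  have "(a + b) ^ 4 = a ^ 4 + b ^ 4 + (4 * a ^ 3 * b + 6 * a ^ 2 * b ^ 2 + 4 * a * b ^ 3)"
    by (simp add: eval_nat_numeral algebra_simps)
  then show ?thesis
    using assms by simp
qed

text \<open>Roots are taken by comparing squares and fourth powers. The constant 200 serves both, as
  200^2 exceeds 19200 and 200^4 = 1600000000 exceeds 16 * 4800 * 3600; Z^5 is raised to Z^6 to
  become the square of Z^3.\<close>

lemma (in loss) norm_kloosterman2_sum_le_min:
  fixes u v w :: int and L M N :: nat and \<alpha> :: "int \<Rightarrow> complex"
  assumes L: "L \<ge> 1"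
    and \<alpha>: "\<And>l. l \<in> {u + 1..u + int L} \<Longrightarrow> norm (\<alpha> l) \<le> 1"
    and \<alpha>0: "\<And>l. l \<in> {u + 1..u + int L} \<Longrightarrow> gcd l (int q) > 1 \<Longrightarrow> \<alpha> l = 0"
  shows "norm (kloosterman2_sum q \<alpha> {u + 1..u + int L} {v + 1..v + int M} {w + 1..w + int N})
    \<le> 200 * Z ^ 3 *
       min ((real L + real L powr (1/2) * real M powr (1/2)) * real N powr (1/2) * real q powr (3/2))
         ((real L + real L powr (3/4) * real M powr (1/4)) *
           (real N powr (1/8) * real q powr (7/4) + real N powr (1/2) * real q powr (3/2)))"
proof -
  define S where "S = norm (kloosterman2_sum q \<alpha> {u + 1..u + int L} {v + 1..v + int M} {w + 1..w + int N})"
  have bounds: "S ^ 2 \<le> 19200 * Z ^ 5 * (real q ^ 3 * real N * (real L ^ 2 + real L * real M))"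
    "S ^ 4 \<le> 16 * 4800 * 3600 * Z ^ 12 * (real L ^ 4 + real L ^ 3 * real M) *
           (real N ^ 2 * real q ^ 6 + sqrt (real N) * real q ^ 7)"
    unfolding S_def by (rule norm_kloosterman2_sum_le[OF L \<alpha> \<alpha>0]; assumption)+
  have pow: "(x powr a) ^ k = x powr (real k * a)" if "k > 0" for x a :: real and k
    using that by (cases "x = 0") (simp_all add: powr_def exp_of_nat_mult[symmetric] mult.assoc)
  define l where "l = real L powr (1/2) * real M powr (1/2)"
  define l' where "l' = real L powr (3/4) * real M powr (1/4)"
  define n where "n = real N powr (1/2)"
  define n' where "n' = real N powr (1/8)"
  define r where "r = real q powr (3/2)"
  define r' where "r' = real q powr (7/4)"
  have nonneg: "l \<ge> 0" "l' \<ge> 0" "n \<ge> 0" "n' \<ge> 0" "r \<ge> 0" "r' \<ge> 0"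
    by (simp_all add: l_def l'_def n_def n'_def r_def r'_def)
  have l: "l ^ 2 = real L * real M" and n: "n ^ 2 = real N" and r: "r ^ 2 = real q ^ 3"
    using q_pos by (simp_all add: l_def n_def r_def power_mult_distrib pow)
  have l': "l' ^ 4 = real L ^ 3 * real M" and n': "n' ^ 4 = sqrt (real N)" and r': "r' ^ 4 = real q ^ 7"
    using q_pos L by (simp_all add: l'_def n'_def r'_def power_mult_distrib pow powr_half_sqrt)
  have n4: "n ^ 4 = real N ^ 2" and r4: "r ^ 4 = real q ^ 6"
    using n r by (simp_all add: power4_eq_xxxx power2_eq_square eval_nat_numeral)
  have "S \<le> 200 * Z ^ 3 * ((real L + l) * n * r)"
  proof (rule power2_le_imp_le)
    have "S ^ 2 \<le> 19200 * Z ^ 5 * (real q ^ 3 * real N * (real L ^ 2 + real L * real M))"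
      by (rule bounds(1))
    also have "\<dots> \<le> 40000 * Z ^ 6 * (real q ^ 3 * real N * (real L + l) ^ 2)"
    proof (intro mult_mono)
      show "real L ^ 2 + real L * real M \<le> (real L + l) ^ 2"
        using nonneg l by (simp add: power2_sum)
      show "Z ^ 5 \<le> Z ^ 6"
        using Z_ge_1 by (intro power_increasing) auto
    qed (use Z_ge_1 in auto)
    also have "\<dots> = (200 * Z ^ 3 * ((real L + l) * n * r)) ^ 2"
      by (simp add: power_mult_distrib n r flip: power_mult)
    finally show "S ^ 2 \<le> (200 * Z ^ 3 * ((real L + l) * n * r)) ^ 2" .
  qed (use nonneg Z_ge_1 in auto)
  moreover have "S \<le> 200 * Z ^ 3 * ((real L + l') * (n' * r' + n * r))"
  proof (rule power_le_imp_le_base)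
    have "S ^ 4 \<le> 16 * 4800 * 3600 * Z ^ 12 * (real L ^ 4 + real L ^ 3 * real M) *
           (real N ^ 2 * real q ^ 6 + sqrt (real N) * real q ^ 7)"
      by (rule bounds(2))
    also have "\<dots> \<le> 1600000000 * Z ^ 12 * (real L + l') ^ 4 * (n' * r' + n * r) ^ 4"
    proof (intro mult_mono)
      show "real L ^ 4 + real L ^ 3 * real M \<le> (real L + l') ^ 4"
        using add_pow4_ge[of "real L" l'] nonneg by (simp add: l')
      show "real N ^ 2 * real q ^ 6 + sqrt (real N) * real q ^ 7 \<le> (n' * r' + n * r) ^ 4"
        using add_pow4_ge[of "n' * r'" "n * r"] nonneg by (simp add: power_mult_distrib n' r' n4 r4)
    qed (use Z_ge_1 in auto)
    also have "\<dots> = (200 * Z ^ 3 * ((real L + l') * (n' * r' + n * r))) ^ 4"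
      by (simp add: power_mult_distrib flip: power_mult)
    finally show "S ^ Suc 3 \<le> (200 * Z ^ 3 * ((real L + l') * (n' * r' + n * r))) ^ Suc 3"
      by simp
  qed (use nonneg Z_ge_1 in auto)
  ultimately show ?thesis
    using Z_ge_1 unfolding S_def[symmetric] l_def[symmetric] l'_def[symmetric] n_def[symmetric]
      n'_def[symmetric] r_def[symmetric] r'_def[symmetric]
    by (simp add: min_def)
qed

theorem theorem1p1:
  shows "\<forall>\<delta>::real. \<delta> > 0 \<longrightarrow> (\<exists>C::real. C > 0 \<and>
    (\<forall>(q::nat) (L::nat) (M::nat) (N::nat) (u::int) (v::int) (w::int) (\<alpha> :: int \<Rightarrow> complex).
       q \<ge> 2 \<longrightarrow> L \<ge> 1 \<longrightarrow> M \<ge> 1 \<longrightarrow> N \<ge> 1 \<longrightarrow>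
       (\<forall>l\<in>{u + 1..u + int L}. norm (\<alpha> l) \<le> 1) \<longrightarrow>
       (\<forall>l\<in>{u + 1..u + int L}. gcd l (int q) > 1 \<longrightarrow> \<alpha> l = 0) \<longrightarrow>
       norm (kloosterman2_sum q \<alpha> {u + 1..u + int L} {v + 1..v + int M} {w + 1..w + int N})
         \<le> C * real q powr \<delta> *
           min ((real L + real L powr (1/2) * real M powr (1/2)) * real N powr (1/2) * real q powr (3/2))
               ((real L + real L powr (3/4) * real M powr (1/4)) *
                (real N powr (1/8) * real q powr (7/4) + real N powr (1/2) * real q powr (3/2)))))"
proof (intro allI impI)
  fix \<delta> :: real assume "\<delta> > 0"
  \<comment> \<open>The divisor bound is applied up to 4 q^4, where the exponent \<delta>/12 costs
    q^(\<delta>/3); the final estimate contains Z^3.\<close>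
  then obtain C0 where C0: "C0 \<ge> 1" "\<And>n. n > 0 \<Longrightarrow> real (divisor_count n) \<le> C0 * real n powr (\<delta> / 12)"
    using divisor_count_le_powr[of "\<delta> / 12"] by auto
  \<comment> \<open>The first summand covers the divisor bound, the second 1 + ln q through ln q
    \<le> (3/\<delta>) q^(\<delta>/3).\<close>
  define C1 where "C1 = C0 * 4 powr (\<delta> / 12) + (1 + 3 / \<delta>)"
  have C1: "C0 * 4 powr (\<delta> / 12) \<le> C1" "1 + 3 / \<delta> \<le> C1" "C1 > 0"
    using C0(1) \<open>\<delta> > 0\<close> by (auto simp: C1_def intro!: add_nonneg_pos)
  show "\<exists>C>0. \<forall>q L M N u v w \<alpha>.
       q \<ge> 2 \<longrightarrow> L \<ge> 1 \<longrightarrow> M \<ge> 1 \<longrightarrow> N \<ge> 1 \<longrightarrow>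
       (\<forall>l\<in>{u + 1..u + int L}. norm (\<alpha> l) \<le> 1) \<longrightarrow>
       (\<forall>l\<in>{u + 1..u + int L}. gcd l (int q) > 1 \<longrightarrow> \<alpha> l = 0) \<longrightarrow>
       norm (kloosterman2_sum q \<alpha> {u + 1..u + int L} {v + 1..v + int M} {w + 1..w + int N})
         \<le> C * real q powr \<delta> *
           min ((real L + real L powr (1/2) * real M powr (1/2)) * real N powr (1/2) * real q powr (3/2))
               ((real L + real L powr (3/4) * real M powr (1/4)) *
                (real N powr (1/8) * real q powr (7/4) + real N powr (1/2) * real q powr (3/2)))"
  proof (intro exI[of _ "200 * C1 ^ 3"] conjI allI impI)
    show "200 * C1 ^ 3 > 0"
      using C1 by simp
  next
    fix q L M N :: nat and u v w :: int and \<alpha> :: "int \<Rightarrow> complex"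
    assume *: "q \<ge> 2" "L \<ge> 1" "M \<ge> 1" "N \<ge> 1" "\<forall>l\<in>{u + 1..u + int L}. norm (\<alpha> l) \<le> 1"
      "\<forall>l\<in>{u + 1..u + int L}. gcd l (int q) > 1 \<longrightarrow> \<alpha> l = 0"
    define Z where "Z = C1 * real q powr (\<delta> / 3)"
    interpret loss q Z
    proof
      fix n :: nat assume n: "0 < n" "n \<le> 4 * q ^ 4"
      have "real n \<le> real (4 * q ^ 4)"
        using n(2) by (rule of_nat_mono)
      then have "real n powr (\<delta> / 12) \<le> (4 * real q ^ 4) powr (\<delta> / 12)"
        using \<open>\<delta> > 0\<close> by (intro powr_mono2) auto
      also have "\<dots> = 4 powr (\<delta> / 12) * (real q powr real 4) powr (\<delta> / 12)"
        using * by (simp only: powr_realpow powr_mult)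
      also have "(real q powr real 4) powr (\<delta> / 12) = real q powr (\<delta> / 3)"
        by (simp only: powr_powr) simp
      finally have "C0 * real n powr (\<delta> / 12) \<le> C0 * (4 powr (\<delta> / 12) * real q powr (\<delta> / 3))"
        using C0(1) by (intro mult_left_mono) auto
      also have "\<dots> \<le> Z"
        unfolding Z_def mult.assoc[symmetric] by (intro mult_right_mono C1) auto
      finally show "real (divisor_count n) \<le> Z"
        using C0(2)[OF n(1)] by linarith
    next
      have "ln (real q) \<le> real q powr (\<delta> / 3) / (\<delta> / 3)"
        using * \<open>\<delta> > 0\<close> by (intro ln_powr_bound) auto
      moreover have "1 \<le> real q powr (\<delta> / 3)"
        using * \<open>\<delta> > 0\<close> by (intro ge_one_powr_ge_zero) auto
      ultimately have "1 + ln (real q) \<le> (1 + 3 / \<delta>) * real q powr (\<delta> / 3)"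
        by (simp add: algebra_simps)
      also have "\<dots> \<le> Z"
        unfolding Z_def by (intro mult_right_mono C1) auto
      finally show "1 + ln (real q) \<le> Z" .
    qed (use * in auto)
    have "Z ^ 3 = C1 ^ 3 * real q powr \<delta>"
      using * by (simp add: Z_def power_mult_distrib powr_power)
    then show "norm (kloosterman2_sum q \<alpha> {u + 1..u + int L} {v + 1..v + int M} {w + 1..w + int N})
         \<le> 200 * C1 ^ 3 * real q powr \<delta> *
           min ((real L + real L powr (1/2) * real M powr (1/2)) * real N powr (1/2) * real q powr (3/2))
               ((real L + real L powr (3/4) * real M powr (1/4)) *
                (real N powr (1/8) * real q powr (7/4) + real N powr (1/2) * real q powr (3/2)))"
      using norm_kloosterman2_sum_le_min[of L u \<alpha> v M w N] * by (simp only: mult.assoc)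
  qed
qed

end
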